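(* Let $V\in L^\infty(\mathbb{R})$ satisfy $0<v_0\le V(x)\le v_1$ for a.e. $x\in\mathbb{R}$, for some constants $v_0,v_1$. Then $F\in W^{2,\infty}_{loc}(\mathbb{R})$ and the following hold: $$F(a)=u_a'(a_-)-u_a'(a_+)\quad(a\in\mathbb{R}),$$ $$F'(a)=|u_a'(a_+)|^2-|u_a'(a_-)|^2\quad(a\in\mathbb{R}),$$ $$F''(a)=2F(a)\left(|u_a'(a_+)|^2+u_a'(a_+)u_a'(a_-)+|u_a'(a_-)|^2-V(a)\right)\quad(\text{a.e. }a\in\mathbb{R}).$$ Moreover, if $V$ is continuous on $\mathbb{R}$, then $F\in C^2(\mathbb{R})$.
   Context: All function spaces are real-valued, $H^1(\mathbb{R})=W^{1,2}(\mathbb{R})$, and Sobolev functions are identified with their continuous (for $W^{2,\infty}_{loc}$, $C^1$) representatives. Write $\|u\|_\infty=\|u\|_{L^\infty(\mathbb{R})}$ and $\|u\|_V^2=\int_{\mathbb{R}}(|u'|^2+V|u|^2)\,dx$. For $a\in\mathbb{R}$ set $K_a:=\{u\in H^1(\mathbb{R}):\ u(a)=\|u\|_\infty=1\}$ and $F(a):=\inf_{u\in K_a}\|u\|_V^2$. Let $u_a$ be the unique minimizer of $\|u\|_V^2$ over $u\in K_a$ (it exists and is unique). The function $u_a$ has right and left derivatives at $x=a$, denoted $u_a'(a_+)$ and $u_a'(a_-)$ respectively. *)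

theory Defs
  imports "HOL-Analysis.Analysis" "HOL-Probability.Essential_Supremum"
begin

definition Ck :: "nat \<Rightarrow> (real \<Rightarrow> real) set" where
  "Ck k = {f. (\<forall>j<k. \<forall>x. (deriv ^^ j) f differentiable (at x)) \<and>
              continuous_on UNIV ((deriv ^^ k) f)}"

definition test_functions :: "(real \<Rightarrow> real) set" where
  "test_functions = {\<phi>. (\<forall>k. \<phi> \<in> Ck k) \<and> compact (closure {x. \<phi> x \<noteq> 0})}"

definition L1_loc :: "(real \<Rightarrow> real) set" where
  "L1_loc = {f. \<forall>K. compact K \<longrightarrow> set_integrable lebesgue K f}"

definition L2 :: "(real \<Rightarrow> real) set" where
  "L2 = {f \<in> borel_measurable lebesgue. integrable lebesgue (\<lambda>x. (f x)\<^sup>2)}"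

definition Linf_norm :: "(real \<Rightarrow> real) \<Rightarrow> ereal" where
  "Linf_norm f = esssup lebesgue (\<lambda>x. ereal \<bar>f x\<bar>)"

definition Linf :: "(real \<Rightarrow> real) set" where
  "Linf = {f \<in> borel_measurable lebesgue. Linf_norm f < \<infinity>}"

definition Linf_loc :: "(real \<Rightarrow> real) set" where
  "Linf_loc = {f. \<forall>K. compact K \<longrightarrow> (\<lambda>x. indicator K x * f x) \<in> Linf}"

definition has_weak_deriv :: "nat \<Rightarrow> (real \<Rightarrow> real) \<Rightarrow> (real \<Rightarrow> real) \<Rightarrow> bool" where
  "has_weak_deriv k f g \<longleftrightarrow> f \<in> L1_loc \<and> g \<in> L1_loc \<and>
     (\<forall>\<phi>\<in>test_functions.
        (LINT x|lebesgue. f x * (deriv ^^ k) \<phi> x) = (-1) ^ k * (LINT x|lebesgue. g x * \<phi> x))"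

text \<open>A weak derivative is determined only up to a null set; \<open>weak_deriv\<close> picks a
  representative, so it should be used only under integrals and almost-everywhere quantifiers.\<close>

definition weak_deriv :: "nat \<Rightarrow> (real \<Rightarrow> real) \<Rightarrow> real \<Rightarrow> real" where
  "weak_deriv k f = (SOME g. has_weak_deriv k f g)"

text \<open>The elements of the Sobolev spaces are functions, not classes: the continuous
  representative for \<open>H1\<close> and the \<open>C\<^sup>1\<close> representative for \<open>W2inf_loc\<close>.\<close>

definition H1 :: "(real \<Rightarrow> real) set" where
  "H1 = {u. continuous_on UNIV u \<and> u \<in> L2 \<and> (\<exists>g\<in>L2. has_weak_deriv 1 u g)}"

definition W2inf_loc :: "(real \<Rightarrow> real) set" where
  "W2inf_loc = {f. f \<in> Ck 1 \<and> f \<in> Linf_loc \<and>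
                   (\<exists>g\<in>Linf_loc. has_weak_deriv 1 f g) \<and>
                   (\<exists>h\<in>Linf_loc. has_weak_deriv 2 f h)}"

definition V_norm_sq :: "(real \<Rightarrow> real) \<Rightarrow> (real \<Rightarrow> real) \<Rightarrow> real" where
  "V_norm_sq V u = (LINT x|lebesgue. \<bar>weak_deriv 1 u x\<bar>\<^sup>2 + V x * \<bar>u x\<bar>\<^sup>2)"

definition K_set :: "real \<Rightarrow> (real \<Rightarrow> real) set" where
  "K_set a = {u \<in> H1. u a = 1 \<and> Linf_norm u = 1}"

definition F_min :: "(real \<Rightarrow> real) \<Rightarrow> real \<Rightarrow> real" where
  "F_min V a = (INF u\<in>K_set a. V_norm_sq V u)"

definition minimizer :: "(real \<Rightarrow> real) \<Rightarrow> real \<Rightarrow> real \<Rightarrow> real" where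
  "minimizer V a = (THE u. u \<in> K_set a \<and> (\<forall>w\<in>K_set a. V_norm_sq V u \<le> V_norm_sq V w))"

definition right_deriv :: "(real \<Rightarrow> real) \<Rightarrow> real \<Rightarrow> real" where
  "right_deriv f x = vector_derivative f (at_right x)"

definition left_deriv :: "(real \<Rightarrow> real) \<Rightarrow> real \<Rightarrow> real" where
  "left_deriv f x = vector_derivative f (at_left x)"

end

theory Submission
  imports Defs
begin

text \<open>The theorem reduces to the Riccati equation \<open>m' = V - m\<^sup>2\<close>, satisfied by the logarithmic derivative
  \<open>m = \<psi>'/\<psi>\<close> of any positive solution of \<open>\<psi>'' = V \<psi>\<close>. Because \<open>0 < v0 \<le> V \<le> v1\<close>, it has one solution
  \<open>m\<^sub>-\<close> with values in \<open>[\<surd>v0, \<surd>v1]\<close> and one solution \<open>m\<^sub>+\<close> with values in \<open>[-\<surd>v1, -\<surd>v0]\<close>, both on the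
  whole line; these belong to the solutions \<open>\<psi>\<close> that decay at \<open>-\<infinity>\<close> and at \<open>+\<infinity>\<close>. They are constructed
  directly, by a contraction argument, in \<open>riccati_positive_solution\<close> and \<open>riccati_negative_solution\<close>.

  For \<open>w\<close> in \<open>H1\<close> with \<open>w a = 1\<close>, integrating \<open>(m w\<^sup>2)' = (w'\<^sup>2 + V w\<^sup>2) - (w' - m w)\<^sup>2\<close> with \<open>m = m\<^sub>-\<close> on
  \<open>{..a}\<close> and with \<open>m = m\<^sub>+\<close> on \<open>{a..}\<close> (\<open>riccati_energy\<close>) gives
  \<open>\<parallel>w\<parallel>\<^sub>V\<^sup>2 = m\<^sub>- a - m\<^sub>+ a + \<integral>\<^bsub>x < a\<^esub> (w' - m\<^sub>- w)\<^sup>2 + \<integral>\<^bsub>x > a\<^esub> (w' - m\<^sub>+ w)\<^sup>2\<close>.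
  Both squares vanish for exactly one \<open>w\<close>, which solves \<open>w' = m\<^sub>- w\<close> and \<open>w' = m\<^sub>+ w\<close> on the two sides. It decays
  exponentially away from its maximum \<open>w a = 1\<close>, so it lies in \<open>K_set a\<close> and is the unique minimizer.
  Hence \<open>F a = m\<^sub>- a - m\<^sub>+ a\<close>, and \<open>m\<^sub>-\<close>, \<open>m\<^sub>+\<close> are the one-sided derivatives of the minimizer at \<open>a\<close>.
  The Riccati equation, used once for \<open>F'\<close> and once more for \<open>F''\<close>, gives the two formulas:
  \<open>V\<close> cancels in \<open>F' = m\<^sub>+\<^sup>2 - m\<^sub>-\<^sup>2\<close>,
  which is therefore continuous, and \<open>F''\<close> is bounded, and continuous if \<open>V\<close> is.

  Since \<open>V\<close> is only measurable, differential equations are understood in integrated form (\<open>primitive\<close>).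
  The calculus rests on the product rule \<open>primitive_mult\<close>; \<open>primitive_has_weak_deriv\<close>,
  \<open>weak_deriv_primitive\<close> and \<open>has_weak_deriv_unique\<close> translate between primitives and weak derivatives.\<close>

section \<open>Locally absolutely continuous functions\<close>

text \<open>\<open>f\<close> is locally absolutely continuous with almost everywhere derivative \<open>g\<close>, in integral form.
  This form suits weak derivatives, as \<open>g\<close> matters only up to null sets.\<close>

definition primitive :: "(real \<Rightarrow> real) \<Rightarrow> (real \<Rightarrow> real) \<Rightarrow> bool" where
  "primitive f g \<longleftrightarrow>
     (\<forall>a b. a \<le> b \<longrightarrow> g absolutely_integrable_on {a..b} \<and> integral {a..b} g = f b - f a)"

lemma primitiveD:
  assumes "primitive f g" "a \<le> b"
  shows "g absolutely_integrable_on {a..b}" "integral {a..b} g = f b - f a"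
    "g integrable_on {a..b}"
  using assms unfolding primitive_def absolutely_integrable_on_def by auto

lemma primitive_continuous:
  assumes "primitive f g"
  shows "continuous_on UNIV f"
proof -
  have "isCont f x" for x
  proof -
    have "continuous_on {x-1..x+1} (\<lambda>t. integral {x-1..t} g)"
      by (rule indefinite_integral_continuous_1) (rule primitiveD(3)[OF assms], simp)
    then have "continuous_on {x-1..x+1} (\<lambda>t. integral {x-1..t} g + f (x-1))"
      by (intro continuous_intros)
    then have "continuous_on {x-1..x+1} f"
      by (rule continuous_on_eq) (use primitiveD(2)[OF assms] in auto)
    then show ?thesis
      by (rule continuous_on_interior) simp
  qed
  then show ?thesis by (simp add: continuous_at_imp_continuous_on)
qed

lemma absolutely_integrable_continuous_times:
  fixes f g :: "real \<Rightarrow> real"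
  assumes "continuous_on {a..b} f" "g absolutely_integrable_on {a..b}"
  shows "(\<lambda>x. f x * g x) absolutely_integrable_on {a..b}"
proof (rule absolutely_integrable_bounded_measurable_product_real)
  show "f \<in> borel_measurable (lebesgue_on {a..b})"
    using assms(1) by (intro continuous_imp_measurable_on_sets_lebesgue) auto
  show "bounded (f ` {a..b})"
    using assms(1) by (intro compact_imp_bounded compact_continuous_image) auto
qed (use assms in auto)

lemma absolutely_integrable_cong:
  fixes f g :: "real \<Rightarrow> real"
  assumes "\<And>x. x \<in> S \<Longrightarrow> f x = g x"
  shows "f absolutely_integrable_on S \<longleftrightarrow> g absolutely_integrable_on S"
  by (rule set_integrable_cong) (use assms in auto)

text \<open>The product rule for locally absolutely continuous functions. Let \<open>D x y\<close> be the amount by which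
  it fails over \<open>{x..y}\<close>. This is additive over adjacent intervals, and near any point it is at most
  \<open>\<epsilon>\<close> times the integral of \<open>p = \<bar>f'\<bar> + \<bar>h'\<bar>\<close>, because \<open>f\<close> and \<open>h\<close> oscillate by at most \<open>\<epsilon>\<close> there.
  A subdivision of \<open>{a..b}\<close> makes the bound global, and \<open>\<epsilon>\<close> is arbitrary.\<close>

theorem primitive_mult:
  assumes "primitive f f'" "primitive h h'"
  shows "primitive (\<lambda>x. f x * h x) (\<lambda>x. f' x * h x + f x * h' x)"
  unfolding primitive_def
proof (intro allI impI conjI)
  fix a b :: real assume ab: "a \<le> b"
  let ?g = "\<lambda>x. f' x * h x + f x * h' x"
  define p where "p = (\<lambda>x. \<bar>f' x\<bar> + \<bar>h' x\<bar>)"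
  note cf = primitive_continuous[OF assms(1)] and ch = primitive_continuous[OF assms(2)]
  have g: "?g absolutely_integrable_on {x..y}" if "x \<le> y" for x y
  proof -
    have "(\<lambda>x. h x * f' x) absolutely_integrable_on {x..y}"
         "(\<lambda>x. f x * h' x) absolutely_integrable_on {x..y}"
      by (intro absolutely_integrable_continuous_times primitiveD(1)[OF assms(1) that]
          primitiveD(1)[OF assms(2) that] continuous_on_subset[OF cf] continuous_on_subset[OF ch]; simp)+
    from set_integral_add(1)[OF this] show ?thesis by (simp add: mult.commute)
  qed
  then show "?g absolutely_integrable_on {a..b}" using ab .
  have p: "p absolutely_integrable_on {x..y}" if "x \<le> y" for x y
    unfolding p_def
    by (intro set_integral_add(1) set_integrable_abs primitiveD(1)[OF assms(1) that]
          primitiveD(1)[OF assms(2) that])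
  have gi: "?g integrable_on {x..y}" and pi: "p integrable_on {x..y}" for x y
    using g[of x y] p[of x y] by (cases "x \<le> y"; auto simp: absolutely_integrable_on_def)+
  define D where "D = (\<lambda>x y. f y * h y - f x * h x - integral {x..y} ?g)"
  have "\<bar>D a b\<bar> \<le> \<epsilon> * integral {a..b} p" if \<epsilon>: "\<epsilon> > 0" for \<epsilon>
  proof (rule Bolzano[where P = "\<lambda>x y. \<bar>D x y\<bar> \<le> \<epsilon> * integral {x..y} p", OF ab])
    fix x y z assume *: "\<bar>D x y\<bar> \<le> \<epsilon> * integral {x..y} p" "\<bar>D y z\<bar> \<le> \<epsilon> * integral {y..z} p" "x \<le> y" "y \<le> z"
    have "D x z = D x y + D y z"
      using Henstock_Kurzweil_Integration.integral_combine[OF *(3,4) gi] by (simp add: D_def)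
    moreover have "integral {x..z} p = integral {x..y} p + integral {y..z} p"
      using Henstock_Kurzweil_Integration.integral_combine[OF *(3,4) pi] by simp
    ultimately show "\<bar>D x z\<bar> \<le> \<epsilon> * integral {x..z} p"
      using * by (simp add: algebra_simps)
  next
    fix x
    from cf ch have "isCont f x" "isCont h x"
      by (auto simp: continuous_on_eq_continuous_at)
    moreover have e2: "0 < \<epsilon>/2" using \<epsilon> by simp
    ultimately have "\<exists>d>0. \<forall>y. \<bar>y - x\<bar> < d \<longrightarrow> \<bar>f y - f x\<bar> < \<epsilon>/2"
      "\<exists>d>0. \<forall>y. \<bar>y - x\<bar> < d \<longrightarrow> \<bar>h y - h x\<bar> < \<epsilon>/2"
      unfolding continuous_at_real_range real_norm_def by blast+
    then obtain d1 d2 where d: "d1 > 0" "d2 > 0"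
      "\<And>y. \<bar>y - x\<bar> < d1 \<Longrightarrow> \<bar>f y - f x\<bar> < \<epsilon>/2" "\<And>y. \<bar>y - x\<bar> < d2 \<Longrightarrow> \<bar>h y - h x\<bar> < \<epsilon>/2"
      by blast
    show "\<exists>d>0. \<forall>s t. s \<le> x \<and> x \<le> t \<and> t - s < d \<longrightarrow> \<bar>D s t\<bar> \<le> \<epsilon> * integral {s..t} p"
    proof (intro exI[of _ "min d1 d2"] conjI allI impI)
      show "min d1 d2 > 0" using d by simp
      fix s t assume st: "s \<le> x \<and> x \<le> t \<and> t - s < min d1 d2"
      then have le: "s \<le> t" by simp
      have osc: "\<bar>f s - f r\<bar> \<le> \<epsilon>" "\<bar>h t - h r\<bar> \<le> \<epsilon>" if "r \<in> {s..t}" for r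
      proof -
        have "\<bar>s - x\<bar> < d1" "\<bar>r - x\<bar> < d1" "\<bar>t - x\<bar> < d2" "\<bar>r - x\<bar> < d2"
          using st that by auto
        from d(3)[OF this(1)] d(3)[OF this(2)] d(4)[OF this(3)] d(4)[OF this(4)]
        show "\<bar>f s - f r\<bar> \<le> \<epsilon>" "\<bar>h t - h r\<bar> \<le> \<epsilon>" by linarith+
      qed
      \<comment> \<open>\<open>f t h t - f s h s = (f t - f s) h t + f s (h t - h s)\<close>, both differences being integrals\<close>
      have i: "((\<lambda>r. f' r * h t + f s * h' r) has_integral (f t * h t - f s * h s)) {s..t}"
      proof -
        have "((\<lambda>r. f' r * h t + f s * h' r) has_integral ((f t - f s) * h t + f s * (h t - h s))) {s..t}"
          using primitiveD(2,3)[OF assms(1) le] primitiveD(2,3)[OF assms(2) le]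
          by (intro has_integral_add has_integral_mult_left has_integral_mult_right)
             (auto simp: has_integral_iff)
        then show ?thesis by (simp add: algebra_simps)
      qed
      have "((\<lambda>r. (f' r * h t + f s * h' r) - ?g r) has_integral D s t) {s..t}"
        unfolding D_def by (intro has_integral_diff i integrable_integral gi)
      then have int: "((\<lambda>r. f' r * (h t - h r) + (f s - f r) * h' r) has_integral D s t) {s..t}"
        by (simp add: algebra_simps)
      moreover have "\<bar>f' r * (h t - h r) + (f s - f r) * h' r\<bar> \<le> \<epsilon> * p r" if "r \<in> {s..t}" for r
      proof -
        have "\<bar>f' r * (h t - h r)\<bar> \<le> \<bar>f' r\<bar> * \<epsilon>" "\<bar>(f s - f r) * h' r\<bar> \<le> \<epsilon> * \<bar>h' r\<bar>"
          unfolding abs_mult using osc[OF that] by (auto intro: mult_left_mono mult_right_mono)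
        then show ?thesis unfolding p_def by (simp add: algebra_simps)
      qed
      ultimately have "norm (integral {s..t} (\<lambda>r. f' r * (h t - h r) + (f s - f r) * h' r)) \<le> integral {s..t} (\<lambda>r. \<epsilon> * p r)"
        by (intro integral_norm_bound_integral integrable_on_mult_right pi) auto
      then show "\<bar>D s t\<bar> \<le> \<epsilon> * integral {s..t} p"
        using int by (simp add: integral_unique)
    qed
  qed
  then have D0: "\<bar>D a b\<bar> \<le> \<epsilon> * integral {a..b} p" if "\<epsilon> > 0" for \<epsilon> using that .
  have p0: "integral {a..b} p \<ge> 0"
    by (intro Henstock_Kurzweil_Integration.integral_nonneg pi) (auto simp: p_def)
  have "\<bar>D a b\<bar> \<le> 0"
  proof (rule field_le_epsilon)
    fix e :: real assume "e > 0"
    then have "\<bar>D a b\<bar> \<le> e / (integral {a..b} p + 1) * integral {a..b} p"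
      using p0 by (intro D0) auto
    also have "\<dots> \<le> e" using p0 \<open>e > 0\<close> by (simp add: field_simps)
    finally show "\<bar>D a b\<bar> \<le> 0 + e" by simp
  qed
  then show "integral {a..b} ?g = f b * h b - f a * h a" by (simp add: D_def)
qed

lemma primitive_minus: "primitive f f' \<Longrightarrow> primitive (\<lambda>x. - f x) (\<lambda>x. - f' x)"
  unfolding primitive_def by (auto simp: set_integrable_def)

lemma primitive_add:
  assumes "primitive f f'" "primitive h h'"
  shows "primitive (\<lambda>x. f x + h x) (\<lambda>x. f' x + h' x)"
  using primitiveD[OF assms(1)] primitiveD[OF assms(2)]
  by (auto simp: primitive_def Henstock_Kurzweil_Integration.integral_add)

lemma primitive_diff:
  assumes "primitive f f'" "primitive h h'"
  shows "primitive (\<lambda>x. f x - h x) (\<lambda>x. f' x - h' x)"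
  using primitive_add[OF assms(1) primitive_minus[OF assms(2)]] by simp

lemma primitive_reflect:
  assumes "primitive f f'"
  shows "primitive (\<lambda>x. - f (- x)) (\<lambda>x. f' (- x))"
  unfolding primitive_def
proof (intro allI impI conjI)
  fix a b :: real assume ab: "a \<le> b"
  then have le: "- b \<le> - a" by simp
  show "(\<lambda>x. f' (- x)) absolutely_integrable_on {a..b}"
    using primitiveD(1)[OF assms le] absolutely_integrable_reflect_real[where f=f' and a="-b" and b="-a"] by simp
  show "integral {a..b} (\<lambda>x. f' (- x)) = - f (- b) - - f (- a)"
    using primitiveD(2)[OF assms le] Henstock_Kurzweil_Integration.integral_reflect_real[where f=f' and a="-b" and b="-a"] by simp
qed

lemma primitive_of_derivative:
  assumes "\<And>x. (f has_real_derivative g x) (at x)" "continuous_on UNIV g"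
  shows "primitive f g"
  unfolding primitive_def
proof (intro allI impI conjI)
  fix a b :: real assume ab: "a \<le> b"
  show "g absolutely_integrable_on {a..b}"
    by (rule absolutely_integrable_continuous_real) (rule continuous_on_subset[OF assms(2)], simp)
  have "(g has_integral (f b - f a)) {a..b}"
    using assms(1) by (intro fundamental_theorem_of_calculus ab)
      (auto simp: has_real_derivative_iff_has_vector_derivative intro: has_vector_derivative_at_within)
  then show "integral {a..b} g = f b - f a" by (rule integral_unique)
qed

text \<open>Together with the previous lemma: for continuous \<open>g\<close>, being a primitive of \<open>g\<close> is the same as having
  derivative \<open>g\<close> everywhere.\<close>

lemma derivative_of_primitive:
  assumes "primitive f g" "continuous_on UNIV g"
  shows "(f has_real_derivative g x) (at x)"
proof -
  have "((\<lambda>t. integral {x-1..t} g) has_real_derivative g x) (at x within {x-1..x+1})"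
    by (rule integral_has_real_derivative) (auto intro: continuous_on_subset[OF assms(2)])
  then have "((\<lambda>t. integral {x-1..t} g + f (x-1)) has_real_derivative g x) (at x within {x-1..x+1})"
    by (auto intro!: derivative_eq_intros)
  then have "(f has_real_derivative g x) (at x within {x-1..x+1})"
    by (rule has_field_derivative_transform_within[where d=1])
       (use primitiveD(2)[OF assms(1)] in auto)
  moreover have "at x within {x-1..x+1} = at x"
    by (rule at_within_interior) simp
  ultimately show ?thesis by simp
qed

lemma primitive_exists:
  assumes "\<And>a b. g absolutely_integrable_on {a..b}"
  shows "\<exists>f. primitive f g"
proof -
  define f where "f = (\<lambda>x. if x \<ge> 0 then integral {0..x} g else - integral {x..0} g)"
  have gi: "g integrable_on {a..b}" for a b using assms absolutely_integrable_on_def by blast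
  have "integral {a..b} g = f b - f a" if ab: "a \<le> b" for a b
  proof -
    consider "a \<ge> 0" | "a < 0" "b \<ge> 0" | "b < 0" by linarith
    then show ?thesis
    proof cases
      case 1 then show ?thesis using Henstock_Kurzweil_Integration.integral_combine[OF 1 ab gi] ab
        by (simp add: f_def)
    next
      case 2 then show ?thesis using Henstock_Kurzweil_Integration.integral_combine[of a 0 b, OF _ _ gi]
        by (simp add: f_def)
    next
      case 3 then show ?thesis using Henstock_Kurzweil_Integration.integral_combine[of a b 0, OF _ _ gi] ab
        by (simp add: f_def)
    qed
  qed
  then show ?thesis using assms unfolding primitive_def by blast
qed

text \<open>The minimizer is an exponential on either side of its peak, so primitives with a corner are needed.\<close>

lemma primitive_glue:
  assumes "primitive f1 g1" "primitive f2 g2" "f1 c = f2 c"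
  shows "primitive (\<lambda>x. if x < c then f1 x else f2 x) (\<lambda>x. if x < c then g1 x else g2 x)"
proof -
  let ?f = "\<lambda>x. if x < c then f1 x else f2 x" and ?g = "\<lambda>x. if x < c then g1 x else g2 x"
  have L: "?g absolutely_integrable_on {a..b}" "(?g has_integral ?f b - ?f a) {a..b}" if "a \<le> b" "b \<le> c" for a b
  proof -
    have n: "negligible {c}" by simp
    show "?g absolutely_integrable_on {a..b}"
      by (rule absolutely_integrable_spike[OF primitiveD(1)[OF assms(1) that(1)] n]) (use that in auto)
    have "(g1 has_integral f1 b - f1 a) {a..b}"
      using primitiveD[OF assms(1) that(1)] by (simp add: has_integral_iff)
    then have "(?g has_integral f1 b - f1 a) {a..b}"
      by (rule has_integral_spike[OF n, rotated]) (use that in auto)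
    then show "(?g has_integral ?f b - ?f a) {a..b}" using that assms(3) by (auto split: if_splits)
  qed
  have R: "?g absolutely_integrable_on {a..b}" "(?g has_integral ?f b - ?f a) {a..b}" if "a \<le> b" "c \<le> a" for a b
  proof -
    have n: "negligible {c}" by simp
    show "?g absolutely_integrable_on {a..b}"
      by (rule absolutely_integrable_spike[OF primitiveD(1)[OF assms(2) that(1)] n]) (use that in auto)
    have "(g2 has_integral f2 b - f2 a) {a..b}"
      using primitiveD[OF assms(2) that(1)] by (simp add: has_integral_iff)
    then have "(?g has_integral f2 b - f2 a) {a..b}"
      by (rule has_integral_spike[OF n, rotated]) (use that in auto)
    then show "(?g has_integral ?f b - ?f a) {a..b}" using that assms(3) by (auto split: if_splits)
  qed
  show ?thesis unfolding primitive_def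
  proof (intro allI impI)
    fix a b :: real assume ab: "a \<le> b"
    consider "b \<le> c" | "c \<le> a" | "a < c" "c < b" by linarith
    then show "?g absolutely_integrable_on {a..b} \<and> integral {a..b} ?g = ?f b - ?f a"
    proof cases
      case 1 then show ?thesis using L ab by (simp add: integral_unique)
    next
      case 2 then show ?thesis using R ab by (simp add: integral_unique)
    next
      case 3
      have u: "{a..b} = {a..c} \<union> {c..b}" using 3 by auto
      have "?g absolutely_integrable_on ({a..c} \<union> {c..b})"
        by (intro set_integrable_Un L R) (use 3 in auto)
      moreover have "(?g has_integral (?f c - ?f a) + (?f b - ?f c)) {a..b}"
        using 3 by (intro has_integral_combine[OF _ _ L(2) R(2)]) auto
      ultimately show ?thesis unfolding u[symmetric] by (auto dest: integral_unique)
    qed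
  qed
qed

section \<open>Smooth functions and bumps\<close>

definition smooth :: "(real \<Rightarrow> real) \<Rightarrow> bool" where
  "smooth f \<longleftrightarrow> (\<forall>k. f \<in> Ck k)"

text \<open>Iterated derivatives are hard to compute explicitly, so smoothness is proved by coinduction: any
  family of differentiable functions that is closed under differentiation consists of smooth ones.\<close>

lemma smooth_coinduct:
  assumes "f \<in> S" and step: "\<And>f. f \<in> S \<Longrightarrow> (\<forall>x. f differentiable (at x)) \<and> deriv f \<in> S"
  shows "smooth f"
proof -
  have S: "(deriv ^^ j) f \<in> S" for j
    by (induction j) (use assms in auto)
  have "(deriv ^^ j) f differentiable (at x)" for j x using S step by blast
  then show ?thesis unfolding smooth_def Ck_def
    by (auto intro!: continuous_at_imp_continuous_on differentiable_imp_continuous_within)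
qed

lemma smooth_differentiable: "smooth f \<Longrightarrow> f differentiable (at x)"
proof -
  assume "smooth f"
  then have "f \<in> Ck (Suc 0)" unfolding smooth_def by blast
  then have "(deriv ^^ 0) f differentiable (at x)" unfolding Ck_def mem_Collect_eq by (elim conjE allE[of _ 0]) simp
  then show ?thesis by simp
qed

lemma smooth_has_derivative: "smooth f \<Longrightarrow> (f has_real_derivative deriv f x) (at x)"
  using smooth_differentiable DERIV_deriv_iff_real_differentiable by blast

lemma smooth_continuous: "smooth f \<Longrightarrow> continuous_on UNIV f"
  unfolding smooth_def Ck_def by (auto dest!: spec[of _ 0])

lemma smooth_deriv: "smooth f \<Longrightarrow> smooth (deriv f)"
proof -
  assume f: "smooth f"
  have *: "(deriv ^^ j) (deriv f) = (deriv ^^ Suc j) f" for j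
    by (simp add: funpow_swap1)
  have "deriv f \<in> Ck k" for k
  proof -
    from f have "f \<in> Ck (Suc k)" unfolding smooth_def by blast
    then have "\<forall>j<k. \<forall>x. (deriv ^^ Suc j) f differentiable at x" "continuous_on UNIV ((deriv ^^ Suc k) f)"
      unfolding Ck_def mem_Collect_eq using Suc_less_eq by blast+
    then show ?thesis unfolding Ck_def mem_Collect_eq * by simp
  qed
  then show ?thesis unfolding smooth_def by blast
qed

lemma smooth_primitive:
  assumes "\<And>x. (f has_real_derivative g x) (at x)" "smooth g"
  shows "smooth f"
proof (rule smooth_coinduct[of _ "insert f {h. smooth h}"])
  fix h assume "h \<in> insert f {h. smooth h}"
  moreover have "deriv f = g" using assms(1) DERIV_imp_deriv by blast
  moreover have "f differentiable at x" for x using assms(1) real_differentiable_def by blast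
  ultimately show "(\<forall>x. h differentiable at x) \<and> deriv h \<in> insert f {h. smooth h}"
    using assms(2) smooth_deriv smooth_differentiable by blast
qed simp

lemma smooth_diff_cmult:
  assumes "smooth f" "smooth g"
  shows "smooth (\<lambda>x. f x - c * g x)"
proof (rule smooth_coinduct[of _ "{\<lambda>x. f x - c * g x | f g. smooth f \<and> smooth g}"])
  fix h assume "h \<in> {\<lambda>x. f x - c * g x | f g. smooth f \<and> smooth g}"
  then obtain f g where h: "h = (\<lambda>x. f x - c * g x)" and fg: "smooth f" "smooth g" by blast
  have d: "(h has_real_derivative deriv f x - c * deriv g x) (at x)" for x
    unfolding h using fg[THEN smooth_has_derivative, of x] by (auto intro!: derivative_eq_intros)
  then have "deriv h = (\<lambda>x. deriv f x - c * deriv g x)" using DERIV_imp_deriv by blast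
  then show "(\<forall>x. h differentiable at x) \<and> deriv h \<in> {\<lambda>x. f x - c * g x | f g. smooth f \<and> smooth g}"
    using d fg smooth_deriv real_differentiable_def by blast
qed (use assms in blast)

text \<open>The derivative of \<open>flat_exp k\<close> is a linear combination of \<open>flat_exp (k + 1)\<close> and \<open>flat_exp (k + 2)\<close>;
  the powers of \<open>x\<close> in the denominator are there to make the family closed under differentiation.\<close>

definition flat_exp :: "nat \<Rightarrow> real \<Rightarrow> real" where
  "flat_exp k x = (if x > 0 then exp (- 1 / x) / x ^ k else 0)"

lemma flat_exp_tendsto_0: "(flat_exp k \<longlongrightarrow> 0) (at 0)"
proof -
  have "((\<lambda>x. x ^ k / exp x) \<longlongrightarrow> (0::real)) at_top" by (rule tendsto_power_div_exp_0)
  then have "((\<lambda>x. inverse x ^ k / exp (inverse x)) \<longlongrightarrow> (0::real)) (at_right 0)"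
    by (rule filterlim_compose[OF _ filterlim_inverse_at_top_right])
  then have r: "(flat_exp k \<longlongrightarrow> 0) (at_right 0)"
  proof (rule Lim_transform_eventually)
    show "\<forall>\<^sub>F x in at_right 0. inverse x ^ k / exp (inverse x) = flat_exp k x"
      by (rule eventually_at_rightI[of 0 1])
         (auto simp: flat_exp_def exp_minus field_simps)
  qed
  have l: "(flat_exp k \<longlongrightarrow> 0) (at_left 0)"
  proof (rule Lim_transform_eventually[OF tendsto_const])
    show "\<forall>\<^sub>F x in at_left 0. 0 = flat_exp k x"
      by (rule eventually_at_leftI[of "-1" 0]) (auto simp: flat_exp_def)
  qed
  from l r show ?thesis by (simp add: filterlim_split_at)
qed

lemma flat_exp_has_derivative:
  "(flat_exp k has_real_derivative flat_exp (k+2) x - real k * flat_exp (k+1) x) (at x)"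
proof -
  consider "x > 0" | "x < 0" | "x = 0" by linarith
  then show ?thesis
  proof cases
    case 1
    have e: "((\<lambda>x. exp (- 1 / x)) has_real_derivative exp (- 1 / x) / x\<^sup>2) (at x)"
      using 1 by (auto intro!: derivative_eq_intros simp: power2_eq_square)
    have q: "((\<lambda>x. inverse (x ^ k)) has_real_derivative - (real k * inverse (x ^ (k + 1)))) (at x)"
    proof (cases k)
      case (Suc j)
      from DERIV_pow[of "Suc j" x UNIV] have "((\<lambda>x. x ^ Suc j) has_real_derivative real (Suc j) * x ^ j) (at x)"
        by simp
      from DERIV_inverse_fun[OF this]
      show ?thesis unfolding Suc
        by (rule DERIV_cong) (use 1 in \<open>simp_all add: field_simps\<close>)
    qed simp
    have "((\<lambda>x. exp (- 1 / x) * inverse (x ^ k)) has_real_derivative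
      exp (- 1 / x) / x\<^sup>2 * inverse (x ^ k) + (- (real k * inverse (x ^ (k + 1)))) * exp (- 1 / x)) (at x)"
      by (rule DERIV_mult[OF e q])
    then have "((\<lambda>x. exp (- 1 / x) / x ^ k) has_real_derivative flat_exp (k+2) x - real k * flat_exp (k+1) x) (at x)"
      using 1 by (simp add: flat_exp_def divide_inverse power_add power2_eq_square mult.commute mult.left_commute)
    then show ?thesis
      by (rule has_field_derivative_transform_within_open[where S="{0<..}"]) (use 1 in \<open>auto simp: flat_exp_def\<close>)
  next
    case 2
    have "((\<lambda>x. 0) has_real_derivative flat_exp (k+2) x - real k * flat_exp (k+1) x) (at x)"
      using 2 by (auto simp: flat_exp_def)
    then show ?thesis
      by (rule has_field_derivative_transform_within_open[where S="{..<0}"]) (use 2 in \<open>auto simp: flat_exp_def\<close>)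
  next
    case 3
    have "((\<lambda>h. (flat_exp k (0 + h) - flat_exp k 0) / h) \<longlongrightarrow> 0) (at 0)"
      by (rule Lim_transform_eventually[OF flat_exp_tendsto_0[of "k+1"]])
         (auto simp: flat_exp_def eventually_at_filter)
    then show ?thesis unfolding DERIV_def using 3 by (simp add: flat_exp_def)
  qed
qed

text \<open>The algebra generated by the functions \<open>flat_exp k\<close> and affine substitutions is closed under
  differentiation, so \<open>smooth_coinduct\<close> applies, and it contains the bump functions below.\<close>

inductive_set flat_algebra :: "(real \<Rightarrow> real) set" where
  flat_exp: "flat_exp k \<in> flat_algebra"
| const: "(\<lambda>_. c) \<in> flat_algebra"
| add: "f \<in> flat_algebra \<Longrightarrow> g \<in> flat_algebra \<Longrightarrow> (\<lambda>x. f x + g x) \<in> flat_algebra"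
| mult: "f \<in> flat_algebra \<Longrightarrow> g \<in> flat_algebra \<Longrightarrow> (\<lambda>x. f x * g x) \<in> flat_algebra"
| affine: "f \<in> flat_algebra \<Longrightarrow> (\<lambda>x. f (c * x + d)) \<in> flat_algebra"

lemma flat_algebra_derivative:
  assumes "f \<in> flat_algebra"
  shows "\<exists>g\<in>flat_algebra. \<forall>x. (f has_real_derivative g x) (at x)"
  using assms
proof induction
  case (flat_exp k)
  have "(\<lambda>x. flat_exp (k+2) x + (\<lambda>_. - real k) x * flat_exp (k+1) x) \<in> flat_algebra"
    by (intro flat_algebra.intros)
  then show ?case using flat_exp_has_derivative[of k] by (auto intro!: bexI)
next
  case (const c)
  then show ?case by (intro bexI[OF _ flat_algebra.const[of 0]]) auto
next
  case (add f g)
  then obtain f' g' where "f' \<in> flat_algebra" "g' \<in> flat_algebra"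
    "\<And>x. (f has_real_derivative f' x) (at x)" "\<And>x. (g has_real_derivative g' x) (at x)" by blast
  then show ?case
    by (intro bexI[OF _ flat_algebra.add[of f' g']]) (auto intro!: derivative_eq_intros)
next
  case (mult f g)
  then obtain f' g' where fg: "f' \<in> flat_algebra" "g' \<in> flat_algebra"
    "\<And>x. (f has_real_derivative f' x) (at x)" "\<And>x. (g has_real_derivative g' x) (at x)" by blast
  have "(\<lambda>x. f' x * g x + g' x * f x) \<in> flat_algebra"
    using mult fg by (intro flat_algebra.add flat_algebra.mult)
  then show ?case
    by (rule bexI[rotated]) (auto intro!: derivative_eq_intros fg)
next
  case (affine f c d)
  then obtain f' where f: "f' \<in> flat_algebra"
    "\<And>x. (f has_real_derivative f' x) (at x)" by blast
  have "(\<lambda>x. f' (c * x + d) * c) \<in> flat_algebra"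
    using flat_algebra.mult[OF flat_algebra.affine[OF f(1)] flat_algebra.const] .
  moreover have "((\<lambda>x. f (c * x + d)) has_real_derivative f' (c * x + d) * c) (at x)" for x
    by (rule DERIV_chain2[OF f(2)]) (auto intro!: derivative_eq_intros)
  ultimately show ?case by (intro bexI[of _ "\<lambda>x. f' (c * x + d) * c"]) auto
qed

lemma flat_algebra_smooth:
  assumes "f \<in> flat_algebra" shows "smooth f"
proof (rule smooth_coinduct[OF assms])
  fix f assume "f \<in> flat_algebra"
  then obtain g where g: "g \<in> flat_algebra" "\<And>x. (f has_real_derivative g x) (at x)"
    using flat_algebra_derivative by blast
  moreover from g(2) have "deriv f = g" using DERIV_imp_deriv by blast
  ultimately show "(\<forall>x. f differentiable at x) \<and> deriv f \<in> flat_algebra"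
    using real_differentiable_def by blast
qed

lemma test_functions_smooth_iff:
  "\<phi> \<in> test_functions \<longleftrightarrow> smooth \<phi> \<and> (\<exists>a b. a < b \<and> (\<forall>x. x \<notin> {a..b} \<longrightarrow> \<phi> x = 0))"
proof -
  have "compact (closure {x. \<phi> x \<noteq> 0}) \<longleftrightarrow> (\<exists>a b. a < b \<and> (\<forall>x. x \<notin> {a..b} \<longrightarrow> \<phi> x = 0))"
  proof
    assume "compact (closure {x. \<phi> x \<noteq> 0})"
    then have "bounded {x. \<phi> x \<noteq> 0}" by simp
    then obtain B where B: "\<And>x. \<phi> x \<noteq> 0 \<Longrightarrow> \<bar>x\<bar> \<le> B" unfolding bounded_iff by auto
    show "\<exists>a b. a < b \<and> (\<forall>x. x \<notin> {a..b} \<longrightarrow> \<phi> x = 0)"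
      by (rule exI[of _ "-\<bar>B\<bar>-1"], rule exI[of _ "\<bar>B\<bar>+1"]) (use B in fastforce)
  next
    assume "\<exists>a b. a < b \<and> (\<forall>x. x \<notin> {a..b} \<longrightarrow> \<phi> x = 0)"
    then obtain a b where "{x. \<phi> x \<noteq> 0} \<subseteq> {a..b}" by blast
    then have "bounded {x. \<phi> x \<noteq> 0}" using bounded_subset bounded_closed_interval by blast
    then show "compact (closure {x. \<phi> x \<noteq> 0})" by simp
  qed
  then show ?thesis unfolding test_functions_def smooth_def by simp
qed

text \<open>For \<open>n \<longlonglongrightarrow> \<infinity>\<close> these test functions converge pointwise to the indicator of \<open>{a<..<b}\<close> and stay
  below it, which is all that dominated convergence asks of them.\<close>

definition bump :: "real \<Rightarrow> real \<Rightarrow> nat \<Rightarrow> real \<Rightarrow> real" where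
  "bump a b n x = flat_exp 0 (real n * (x - a)) * flat_exp 0 (real n * (b - x))"

lemma bump_test:
  assumes "a < b" shows "bump a b n \<in> test_functions"
proof -
  have "(\<lambda>x. flat_exp 0 (real n * x + (- real n * a)) * flat_exp 0 ((- real n) * x + real n * b)) \<in> flat_algebra"
    by (intro flat_algebra.mult flat_algebra.affine flat_algebra.flat_exp)
  then have "bump a b n \<in> flat_algebra" unfolding bump_def by (simp add: algebra_simps)
  moreover have "bump a b n x = 0" if "x \<notin> {a..b}" for x
    using that by (auto simp: bump_def flat_exp_def zero_less_mult_iff)
  ultimately show ?thesis unfolding test_functions_smooth_iff using assms flat_algebra_smooth by blast
qed

lemma bump_bounds: "0 \<le> bump a b n x" "bump a b n x \<le> indicator {a<..<b} x"
proof -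
  have *: "0 \<le> flat_exp 0 y" "flat_exp 0 y \<le> 1" for y by (auto simp: flat_exp_def)
  then show "0 \<le> bump a b n x" by (simp add: bump_def)
  show "bump a b n x \<le> indicator {a<..<b} x"
  proof (cases "x \<in> {a<..<b}")
    case True then show ?thesis using * by (auto simp: bump_def intro: mult_le_one)
  next
    case False then show ?thesis by (auto simp: bump_def flat_exp_def zero_less_mult_iff)
  qed
qed

lemma bump_tendsto: "(\<lambda>n. bump a b n x) \<longlonglongrightarrow> indicator {a<..<b} x"
proof (cases "x \<in> {a<..<b}")
  case True
  have *: "(\<lambda>n. flat_exp 0 (real n * y)) \<longlonglongrightarrow> 1" if "y > 0" for y
  proof -
    have "(\<lambda>n. exp (- (1 / y * inverse (real n)))) \<longlonglongrightarrow> exp (- (1 / y * 0))"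
      by (intro tendsto_intros lim_inverse_n)
    then have "(\<lambda>n. exp (- (1 / y * inverse (real n)))) \<longlonglongrightarrow> 1" by simp
    then show ?thesis
      by (rule Lim_transform_eventually)
         (use that in \<open>auto simp: flat_exp_def field_simps intro!: eventually_sequentiallyI[of 1]\<close>)
  qed
  have "(\<lambda>n. bump a b n x) \<longlonglongrightarrow> 1 * 1"
    unfolding bump_def by (intro tendsto_mult *) (use True in auto)
  with True show ?thesis by simp
next
  case False
  then have "bump a b n x = 0" for n by (auto simp: bump_def flat_exp_def zero_less_mult_iff)
  with False show ?thesis by simp
qed

section \<open>Weak derivatives\<close>

lemma L1_locI:
  assumes "\<And>a b. f absolutely_integrable_on {a..b}"
  shows "f \<in> L1_loc"
  unfolding L1_loc_def
proof (intro CollectI allI impI)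
  fix K :: "real set" assume K: "compact K"
  then obtain B where B: "K \<subseteq> {-B..B}"
    by (metis bounded_subset_cbox_symmetric compact_imp_bounded interval_cbox)
  show "f absolutely_integrable_on K"
    by (rule set_integrable_subset[OF assms fmeasurableD[OF lmeasurable_compact[OF K]] B])
qed

lemma L1_locD: "f \<in> L1_loc \<Longrightarrow> f absolutely_integrable_on {a..b}"
  unfolding L1_loc_def by simp

lemma primitive_L1_loc:
  assumes "primitive f g" shows "g \<in> L1_loc" "f \<in> L1_loc"
proof -
  have "g absolutely_integrable_on {a..b}" for a b
    using primitiveD(1)[OF assms, of a b] by (cases "a \<le> b") auto
  then show "g \<in> L1_loc" by (rule L1_locI)
  show "f \<in> L1_loc"
    by (intro L1_locI absolutely_integrable_continuous_real continuous_on_subset[OF primitive_continuous[OF assms]]) simp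
qed

lemma L1_loc_primitive: "g \<in> L1_loc \<Longrightarrow> \<exists>f. primitive f g"
  by (intro primitive_exists L1_locD)

lemma test_function_smooth: "\<phi> \<in> test_functions \<Longrightarrow> smooth \<phi>"
  by (simp add: test_functions_smooth_iff)

lemma deriv_zero_outside:
  assumes "\<And>x. x \<notin> {a..b} \<Longrightarrow> \<phi> x = 0" and x: "x \<notin> {a..b}"
  shows "deriv \<phi> x = (0 :: real)"
proof (rule DERIV_imp_deriv)
  have "((\<lambda>_. 0) has_real_derivative 0) (at x)" by simp
  then show "(\<phi> has_real_derivative 0) (at x)"
    by (rule has_field_derivative_transform_within_open[where S="-{a..b}"]) (use assms in auto)
qed

lemma test_function_deriv:
  assumes "\<phi> \<in> test_functions" shows "deriv \<phi> \<in> test_functions"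
proof -
  from assms obtain a b where ab: "a < b" "\<And>x. x \<notin> {a..b} \<Longrightarrow> \<phi> x = 0" and s: "smooth \<phi>"
    unfolding test_functions_smooth_iff by blast
  have "deriv \<phi> x = 0" if "x \<notin> {a..b}" for x
    using ab(2) that by (rule deriv_zero_outside)
  then show ?thesis using ab(1) smooth_deriv[OF s] unfolding test_functions_smooth_iff by blast
qed

lemma LINT_eq_integral_of_support:
  fixes f :: "real \<Rightarrow> real"
  assumes "f absolutely_integrable_on {a..b}" "\<And>x. x \<notin> {a..b} \<Longrightarrow> f x = 0"
  shows "integrable lebesgue f" "(LINT x|lebesgue. f x) = integral {a..b} f"
proof -
  have *: "(\<lambda>x. indicator {a..b} x *\<^sub>R f x) = f"
    using assms(2) by (auto simp: indicator_def fun_eq_iff)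
  from assms(1) show "integrable lebesgue f" unfolding set_integrable_def * .
  have "(LINT x:{a..b}|lebesgue. f x) = integral {a..b} f"
    by (rule set_lebesgue_integral_eq_integral(2)[OF assms(1)])
  then show "(LINT x|lebesgue. f x) = integral {a..b} f" unfolding set_lebesgue_integral_def * .
qed

lemma absolutely_integrable_times_test:
  assumes "f \<in> L1_loc" "\<phi> \<in> test_functions"
  shows "(\<lambda>x. f x * \<phi> x) absolutely_integrable_on {a..b}"
proof -
  have "(\<lambda>x. \<phi> x * f x) absolutely_integrable_on {a..b}"
    by (intro absolutely_integrable_continuous_times L1_locD assms continuous_on_subset[OF smooth_continuous]
        test_function_smooth) simp
  then show ?thesis by (simp add: mult.commute)
qed

lemma integrable_times_test:
  assumes "f \<in> L1_loc" "\<phi> \<in> test_functions"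
  shows "integrable lebesgue (\<lambda>x. f x * \<phi> x)"
proof -
  from assms obtain a b where "\<And>x. x \<notin> {a..b} \<Longrightarrow> \<phi> x = 0"
    unfolding test_functions_smooth_iff by blast
  then show ?thesis
    by (intro LINT_eq_integral_of_support(1)[OF absolutely_integrable_times_test[OF assms, of a b]]) simp
qed

lemma primitive_deriv_smooth: "smooth \<phi> \<Longrightarrow> primitive \<phi> (deriv \<phi>)"
  by (intro primitive_of_derivative smooth_has_derivative smooth_continuous smooth_deriv)

text \<open>Integration by parts: apply the product rule to \<open>f\<close> and a test function on an interval so large
  that the boundary terms vanish.\<close>

theorem primitive_has_weak_deriv:
  assumes "primitive f g" shows "has_weak_deriv 1 f g"
  unfolding has_weak_deriv_def
proof (intro conjI ballI primitive_L1_loc[OF assms])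
  fix \<phi> assume t: "\<phi> \<in> test_functions"
  then obtain a b where ab: "a < b" "\<And>x. x \<notin> {a..b} \<Longrightarrow> \<phi> x = 0" and s: "smooth \<phi>"
    unfolding test_functions_smooth_iff by blast
  have td: "deriv \<phi> \<in> test_functions" by (rule test_function_deriv[OF t])
  note i = integrable_times_test[OF primitive_L1_loc(1)[OF assms] t]
    integrable_times_test[OF primitive_L1_loc(2)[OF assms] td]
  have p: "primitive (\<lambda>x. f x * \<phi> x) (\<lambda>x. g x * \<phi> x + f x * deriv \<phi> x)"
    by (rule primitive_mult[OF assms primitive_deriv_smooth[OF s]])
  have z: "deriv \<phi> x = 0" if "x \<notin> {a..b}" for x
    using ab(2) that by (rule deriv_zero_outside)
  have "(LINT x|lebesgue. g x * \<phi> x + f x * deriv \<phi> x) = integral {a-1..b+1} (\<lambda>x. g x * \<phi> x + f x * deriv \<phi> x)"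
    by (rule LINT_eq_integral_of_support(2)) (use ab z primitiveD(1)[OF p, of "a-1" "b+1"] in auto)
  also have "\<dots> = 0"
    using primitiveD(2)[OF p, of "a-1" "b+1"] ab by simp
  finally show "(LINT x|lebesgue. f x * (deriv ^^ 1) \<phi> x) = (-1) ^ 1 * (LINT x|lebesgue. g x * \<phi> x)"
    using Bochner_Integration.integral_add[OF i] by simp
qed

lemma has_weak_deriv_2:
  assumes "has_weak_deriv 1 f g" "has_weak_deriv 1 g h"
  shows "has_weak_deriv 2 f h"
  using assms test_function_deriv unfolding has_weak_deriv_def
  by (auto simp: numeral_2_eq_2)

text \<open>The fundamental lemma of the calculus of variations, in integrated form: testing against bumps that
  increase to the indicator of \<open>{a<..<b}\<close> gives \<open>\<integral>\<^bsub>a\<^esub>\<^bsup>b\<^esup> g = 0\<close> by dominated convergence.\<close>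

theorem fundamental_lemma:
  assumes g: "g \<in> L1_loc" and orth: "\<And>\<phi>. \<phi> \<in> test_functions \<Longrightarrow> (LINT x|lebesgue. g x * \<phi> x) = 0"
  shows "primitive (\<lambda>_. 0) g"
  unfolding primitive_def
proof (intro allI impI conjI L1_locD[OF g])
  fix a b :: real assume "a \<le> b"
  show "integral {a..b} g = 0 - 0"
  proof (cases "a < b")
    case True
    have gi: "integrable lebesgue (\<lambda>x. indicator {a..b} x *\<^sub>R g x)"
      using L1_locD[OF g, of a b] unfolding set_integrable_def .
    have "(\<lambda>n. LINT x|lebesgue. g x * bump a b n x) \<longlonglongrightarrow> (LINT x|lebesgue. g x * indicator {a<..<b} x)"
    proof (rule integral_dominated_convergence)
      have "set_integrable lebesgue {a<..<b} g"
        by (rule set_integrable_subset[OF L1_locD[OF g, of a b]]) auto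
      then show "(\<lambda>x. g x * indicator {a<..<b} x) \<in> borel_measurable lebesgue"
        unfolding set_integrable_def by (simp add: mult.commute)
      show "(\<lambda>x. g x * bump a b n x) \<in> borel_measurable lebesgue" for n
        using integrable_times_test[OF g bump_test[OF True]] by blast
      show "integrable lebesgue (\<lambda>x. \<bar>indicator {a..b} x *\<^sub>R g x\<bar>)" using gi by (rule integrable_abs)
      show "AE x in lebesgue. (\<lambda>n. g x * bump a b n x) \<longlonglongrightarrow> g x * indicator {a<..<b} x"
        by (intro AE_I2 tendsto_intros bump_tendsto)
      show "AE x in lebesgue. norm (g x * bump a b n x) \<le> \<bar>indicator {a..b} x *\<^sub>R g x\<bar>" for n
      proof (rule AE_I2)
        fix x
        show "norm (g x * bump a b n x) \<le> \<bar>indicator {a..b} x *\<^sub>R g x\<bar>"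
          using bump_bounds[of a b n x]
          by (cases "x \<in> {a<..<b}") (auto simp: abs_mult indicator_def intro: mult_left_le)
      qed
    qed
    then have "(LINT x|lebesgue. g x * indicator {a<..<b} x) = 0"
      by (simp add: orth[OF bump_test[OF True]] LIMSEQ_const_iff)
    then have "(LINT x:{a<..<b}|lebesgue. g x) = 0"
      unfolding set_lebesgue_integral_def by (simp add: mult.commute)
    moreover have "g absolutely_integrable_on {a<..<b}"
      by (rule set_integrable_subset[OF L1_locD[OF g, of a b]]) auto
    ultimately have "integral {a<..<b} g = 0"
      using set_lebesgue_integral_eq_integral(2) by metis
    then show ?thesis
      using integral_open_interval_real[of a b g] by simp
  next
    case False
    then show ?thesis using \<open>a \<le> b\<close> by simp
  qed
qed

text \<open>The half-lines \<open>{..t}\<close> are stable under intersection and generate the Borel sets. A Dynkin argument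
  therefore extends the vanishing of the integral from intervals to all Borel sets, and then the
  density itself vanishes. The argument runs on the window \<open>{-n..n}\<close>, where \<open>g\<close> is integrable, with a
  Borel representative \<open>k'\<close> of the truncated density \<open>k\<close>.\<close>

lemma primitive_zero_AE:
  assumes p: "primitive (\<lambda>_. 0) g"
  shows "AE x in lebesgue. g x = 0"
proof -
  have "AE x in lebesgue. x \<in> {-real n..real n} \<longrightarrow> g x = 0" for n
  proof -
    define k where "k = (\<lambda>x. indicator {-real n..real n} x *\<^sub>R g x)"
    have ki: "integrable lebesgue k"
      unfolding k_def using primitiveD(1)[OF p, of "-real n" "real n"] unfolding set_integrable_def by simp
    obtain k' where k': "k' \<in> borel_measurable lborel" "AE x in lborel. k x = k' x"
      using completion_ex_borel_measurable_real[of k lborel] ki by auto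
    have AE: "AE x in lebesgue. k x = k' x" using k'(2) by (rule AE_completion)
    have m': "k' \<in> borel_measurable lebesgue" using k'(1) by (rule measurable_completion)
    have mk: "k \<in> borel_measurable lebesgue" using ki by blast
    have ki': "integrable lebesgue k'"
      using ki integrable_cong_AE[OF _ m' AE] by blast
    then have kl: "integrable lborel k'" using integrable_completion[OF k'(1)] by simp
    have LINT0: "(LINT x|lebesgue. indicator {..t} x *\<^sub>R k x) = 0" for t
    proof -
      have eq: "indicator {..t} x *\<^sub>R k x = indicator {-real n..min t (real n)} x *\<^sub>R g x" for x
        by (auto simp: k_def indicator_def)
      have "g absolutely_integrable_on {-real n..min t (real n)}"
        using primitiveD(1)[OF p, of "-real n" "min t (real n)"] by (cases "-real n \<le> min t (real n)") auto
      from set_lebesgue_integral_eq_integral(2)[OF this]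
      show ?thesis unfolding eq set_lebesgue_integral_def
        using primitiveD(2)[OF p, of "-real n" "min t (real n)"] by (cases "-real n \<le> min t (real n)") auto
    qed
    have "set_lebesgue_integral lborel A k' = 0" if "A \<in> sets lborel" for A
    proof -
      have A: "A \<in> sigma_sets UNIV (range atMost)"
        using that by (simp add: borel_eq_atMost)
      have si: "set_integrable lborel A k'" if "A \<in> sigma_sets UNIV (range atMost)" for A
      proof -
        have "A \<in> sets lborel" using that by (simp add: borel_eq_atMost)
        then show ?thesis unfolding set_integrable_def using kl by (rule integrable_mult_indicator)
      qed
      have base: "set_lebesgue_integral lborel {..t} k' = 0" for t
      proof -
        have "set_lebesgue_integral lborel {..t} k' = (LINT x|lebesgue. indicator {..t} x *\<^sub>R k' x)"
          unfolding set_lebesgue_integral_def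
          by (rule integral_completion[symmetric], intro borel_measurable_scaleR borel_measurable_indicator k'(1)) simp
        also have "\<dots> = (LINT x|lebesgue. indicator {..t} x *\<^sub>R k x)"
        proof (rule integral_cong_AE)
          show "AE x in lebesgue. indicator {..t} x *\<^sub>R k' x = indicator {..t} x *\<^sub>R k x"
            using AE by eventually_elim simp
        qed (intro borel_measurable_scaleR borel_measurable_indicator m' mk; simp)+
        finally show ?thesis using LINT0 by simp
      qed
      have total: "set_lebesgue_integral lborel UNIV k' = 0"
      proof -
        have "set_lebesgue_integral lborel UNIV k' = (LINT x|lebesgue. k' x)"
          unfolding set_lebesgue_integral_def using k'(1) by (subst integral_completion) auto
        also have "\<dots> = (LINT x|lebesgue. indicator {..real n} x *\<^sub>R k x)"
        proof (rule integral_cong_AE)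
          show "AE x in lebesgue. k' x = indicator {..real n} x *\<^sub>R k x"
            using AE by eventually_elim (auto simp: k_def indicator_def)
        qed (intro borel_measurable_scaleR borel_measurable_indicator m' mk; simp)+
        finally show ?thesis using LINT0 by simp
      qed
      have Int: "Int_stable (range (atMost :: real \<Rightarrow> real set))" by (auto simp: Int_stable_def)
      have "range (atMost :: real \<Rightarrow> real set) \<subseteq> Pow UNIV" by simp
      from Int this A show ?thesis
      proof (induction rule: sigma_sets_induct_disjoint)
        case (basic A) then show ?case using base by auto
      next
        case empty then show ?case by (simp add: set_lebesgue_integral_def)
      next
        case (compl A)
        have "set_lebesgue_integral lborel (A \<union> (UNIV - A)) k' =
          set_lebesgue_integral lborel A k' + set_lebesgue_integral lborel (UNIV - A) k'"
          using compl by (intro set_integral_Un si) (auto intro: sigma_sets.Compl)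
        then show ?case using compl total by simp
      next
        case (union A)
        have "set_lebesgue_integral lborel (\<Union>i. A i) k' = (\<Sum>i. set_lebesgue_integral lborel (A i) k')"
        proof (rule lebesgue_integral_countable_add)
          show "A i \<in> sets lborel" for i using union(2) by (auto simp: borel_eq_atMost)
          show "A i \<inter> A j = {}" if "i \<noteq> j" for i j
            using union(1) that by (auto simp: disjoint_family_on_def)
          show "set_integrable lborel (\<Union>i. A i) k'"
            by (intro si sigma_sets.Union) (use union(2) in auto)
        qed
        then show ?case using union by simp
      qed
    qed
    then have "AE x in lborel. k' x = 0"
      using sigma_finite_measure.density_zero[OF lborel.sigma_finite_measure_axioms kl] by blast
    then have "AE x in lebesgue. k' x = 0" by (rule AE_completion)
    with AE show ?thesis by eventually_elim (auto simp: k_def)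
  qed
  then have "AE x in lebesgue. \<forall>n::nat. x \<in> {-real n..real n} \<longrightarrow> g x = 0"
    unfolding AE_all_countable by blast
  then show ?thesis
  proof eventually_elim
    case (elim x)
    obtain n :: nat where "\<bar>x\<bar> \<le> real n" using real_arch_simple by blast
    then have "x \<in> {-real n..real n}" by (simp add: abs_le_iff)
    with elim show ?case by blast
  qed
qed

lemma has_weak_deriv_unique:
  assumes "has_weak_deriv k f g" "has_weak_deriv k f h"
  shows "AE x in lebesgue. g x = h x"
proof -
  have L: "g \<in> L1_loc" "h \<in> L1_loc" using assms unfolding has_weak_deriv_def by auto
  have "primitive (\<lambda>_. 0) (\<lambda>x. g x - h x)"
  proof (rule fundamental_lemma)
    show "(\<lambda>x. g x - h x) \<in> L1_loc"
      by (rule L1_locI, rule set_integral_diff(1); rule L1_locD, fact L)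
    fix \<phi> assume t: "\<phi> \<in> test_functions"
    then have "(-1) ^ k * (LINT x|lebesgue. g x * \<phi> x) = (-1) ^ k * (LINT x|lebesgue. h x * \<phi> x)"
      using assms[unfolded has_weak_deriv_def, THEN conjunct2, THEN conjunct2, THEN bspec, OF t] by simp
    then show "(LINT x|lebesgue. (g x - h x) * \<phi> x) = 0"
      by (simp add: left_diff_distrib integrable_times_test[OF L(1) t] integrable_times_test[OF L(2) t])
  qed
  from primitive_zero_AE[OF this] show ?thesis by simp
qed

lemma weak_deriv_AE:
  assumes "has_weak_deriv k f g" shows "AE x in lebesgue. weak_deriv k f x = g x"
  by (rule has_weak_deriv_unique[OF _ assms]) (unfold weak_deriv_def, rule someI[of "has_weak_deriv k f", OF assms])

text \<open>The du Bois-Reymond lemma for continuous functions. Fix a test function \<open>\<eta>\<close> with nonzero integral.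
  Any test function minus a suitable multiple of \<open>\<eta>\<close> has mean zero and hence is the derivative of a
  test function, so \<open>w\<close> minus its \<open>\<eta>\<close>-average \<open>c\<close> is orthogonal to every test function.\<close>

lemma weakly_constant:
  assumes w: "continuous_on UNIV w"
    and orth: "\<And>\<phi>. \<phi> \<in> test_functions \<Longrightarrow> (LINT x|lebesgue. w x * deriv \<phi> x) = 0"
  shows "w x = w y"
proof -
  define \<eta> where "\<eta> = bump 0 1 1"
  have \<eta>: "\<eta> \<in> test_functions" unfolding \<eta>_def by (rule bump_test) simp
  have \<eta>01: "\<eta> x = 0" if "x \<notin> {0..1}" for x
    using bump_bounds[of 0 1 1 x] that by (auto simp: \<eta>_def)
  have wL: "w \<in> L1_loc"
    by (intro L1_locI absolutely_integrable_continuous_real continuous_on_subset[OF w]) simp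
  have "(\<lambda>x. 1 :: real) \<in> L1_loc"
    by (intro L1_locI absolutely_integrable_continuous_real) simp
  note one = integrable_times_test[OF this, simplified]
  have I\<eta>: "(LINT x|lebesgue. \<eta> x) \<noteq> 0"
  proof
    assume "(LINT x|lebesgue. \<eta> x) = 0"
    then have "AE x in lebesgue. \<eta> x = 0"
      using integral_nonneg_eq_0_iff_AE[OF one[OF \<eta>]] bump_bounds(1) by (simp add: \<eta>_def)
    then have "negligible {x. \<eta> x \<noteq> 0}"
      by (simp add: negligible_iff_null_sets AE_iff_null_sets  eventually_ae_filter)
        (metis (no_types, lifting) completion.complete2 mem_Collect_eq subset_eq)
    then have "negligible {0<..<1::real}"
      by (rule negligible_subset) (auto simp: \<eta>_def bump_def flat_exp_def)
    then show False using open_not_negligible[of "{0<..<1::real}"] by simp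
  qed
  define c where "c = (LINT x|lebesgue. w x * \<eta> x) / (LINT x|lebesgue. \<eta> x)"
  have "primitive (\<lambda>_. 0) (\<lambda>x. w x - c)"
  proof (rule fundamental_lemma)
    show "(\<lambda>x. w x - c) \<in> L1_loc"
      by (intro L1_locI absolutely_integrable_continuous_real continuous_intros continuous_on_subset[OF w]) simp
    fix \<phi> assume t: "\<phi> \<in> test_functions"
    define r where "r = (LINT x|lebesgue. \<phi> x) / (LINT x|lebesgue. \<eta> x)"
    \<comment> \<open>\<open>r\<close> is chosen to give \<open>\<psi>\<close> mean zero, so that its antiderivative \<open>\<theta>\<close> has compact support\<close>
    define \<psi> where "\<psi> = (\<lambda>x. \<phi> x - r * \<eta> x)"
    from t obtain a b where ab: "a < b" "\<And>x. x \<notin> {a..b} \<Longrightarrow> \<phi> x = 0" and s: "smooth \<phi>"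
      unfolding test_functions_smooth_iff by blast
    have \<psi>: "smooth \<psi>" unfolding \<psi>_def by (intro smooth_diff_cmult s test_function_smooth \<eta>)
    define A B where "A = min a 0" and "B = max b 1"
    have AB: "A < B" using ab(1) by (simp add: A_def B_def)
    have \<psi>0: "\<psi> x = 0" if "x \<notin> {A..B}" for x
    proof -
      have "x \<notin> {a..b}" "x \<notin> {0..1}" using that by (auto simp: A_def B_def)
      from ab(2)[OF this(1)] \<eta>01[OF this(2)] show ?thesis by (simp add: \<psi>_def)
    qed
    have \<psi>i: "\<psi> absolutely_integrable_on {s..t}" for s t
      by (intro absolutely_integrable_continuous_real continuous_on_subset[OF smooth_continuous[OF \<psi>]]) simp
    have "\<exists>\<theta>0. primitive \<theta>0 \<psi>" by (rule primitive_exists) (rule \<psi>i)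
    then obtain \<theta>0 where \<theta>0: "primitive \<theta>0 \<psi>" ..
    define \<theta> where "\<theta> = (\<lambda>x. \<theta>0 x - \<theta>0 A)"
    have \<theta>': "(\<theta> has_real_derivative \<psi> x) (at x)" for x
    proof -
      have "(\<theta>0 has_real_derivative \<psi> x) (at x)"
        by (rule derivative_of_primitive[OF \<theta>0 smooth_continuous[OF \<psi>]])
      from DERIV_diff[OF this DERIV_const[of "\<theta>0 A"]] show ?thesis
        unfolding \<theta>_def diff_zero .
    qed
    have "(LINT x|lebesgue. \<psi> x) = (LINT x|lebesgue. \<phi> x) - r * (LINT x|lebesgue. \<eta> x)"
      unfolding \<psi>_def using one[OF t] one[OF \<eta>] by simp
    also have "\<dots> = 0" using I\<eta> by (simp add: r_def)
    finally have I\<psi>: "integral {A..B} \<psi> = 0"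
      using LINT_eq_integral_of_support(2)[OF \<psi>i \<psi>0] by simp
    have "\<theta> x = 0" if x: "x \<notin> {A..B}" for x
    proof (cases "x < A")
      case True
      then have "integral {x..A} \<psi> = integral {x..A} (\<lambda>_. 0)"
        using \<psi>0 by (intro integral_spike[of "{A}"]) auto
      then show ?thesis using primitiveD(2)[OF \<theta>0, of x A] True by (simp add: \<theta>_def)
    next
      case False
      then have "B < x" using x by auto
      then have "integral {B..x} \<psi> = integral {B..x} (\<lambda>_. 0)"
        using \<psi>0 by (intro integral_spike[of "{B}"]) auto
      then show ?thesis using primitiveD(2)[OF \<theta>0, of B x] primitiveD(2)[OF \<theta>0, of A B] I\<psi> AB \<open>B < x\<close>
        by (simp add: \<theta>_def)
    qed
    then have "\<theta> \<in> test_functions"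
      unfolding test_functions_smooth_iff using smooth_primitive[OF \<theta>' \<psi>] AB by blast
    moreover have "deriv \<theta> = \<psi>" using \<theta>' DERIV_imp_deriv by blast
    ultimately have "(LINT x|lebesgue. w x * \<psi> x) = 0" using orth by metis
    moreover have "(LINT x|lebesgue. w x * \<psi> x) = (LINT x|lebesgue. w x * \<phi> x - r * (w x * \<eta> x))"
      by (simp add: \<psi>_def algebra_simps)
    ultimately have "(LINT x|lebesgue. w x * \<phi> x) = r * (LINT x|lebesgue. w x * \<eta> x)"
      using integrable_times_test[OF wL t] integrable_times_test[OF wL \<eta>] by simp
    then show "(LINT x|lebesgue. (w x - c) * \<phi> x) = 0"
      using integrable_times_test[OF wL t] one[OF t] by (simp add: left_diff_distrib r_def c_def)
  qed
  then have "((\<lambda>_. 0) has_real_derivative w x - c) (at x)" for x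
    by (rule derivative_of_primitive) (intro continuous_intros w)
  then have "w x - c = 0" for x using DERIV_unique[OF _ DERIV_const] by blast
  then show ?thesis by (metis eq_iff_diff_eq_0)
qed

text \<open>A primitive \<open>G\<close> of \<open>g\<close> has the same weak derivative as \<open>u\<close>, so \<open>u - G\<close> is weakly constant. With
  \<open>primitive_has_weak_deriv\<close> this identifies continuous Sobolev functions with primitives.\<close>

theorem weak_deriv_primitive:
  assumes u: "continuous_on UNIV u" and g: "has_weak_deriv 1 u g"
  shows "primitive u g"
proof -
  have L: "g \<in> L1_loc" "u \<in> L1_loc" using g unfolding has_weak_deriv_def by auto
  obtain G where G: "primitive G g" using L1_loc_primitive[OF L(1)] by blast
  have GL: "G \<in> L1_loc" by (rule primitive_L1_loc(2)[OF G])
  have wd: "has_weak_deriv 1 G g" by (rule primitive_has_weak_deriv[OF G])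
  have const: "u x - G x = u y - G y" for x y
  proof (rule weakly_constant[where w="\<lambda>x. u x - G x"])
    show "continuous_on UNIV (\<lambda>x. u x - G x)" by (intro continuous_intros u primitive_continuous[OF G])
    fix \<phi> assume t: "\<phi> \<in> test_functions"
    have "(LINT x|lebesgue. u x * deriv \<phi> x) = (LINT x|lebesgue. G x * deriv \<phi> x)"
      using g wd t unfolding has_weak_deriv_def by simp
    then show "(LINT x|lebesgue. (u x - G x) * deriv \<phi> x) = 0"
      using integrable_times_test[OF L(2) test_function_deriv[OF t]]
        integrable_times_test[OF GL test_function_deriv[OF t]] by (simp add: left_diff_distrib)
  qed
  then have "G b - G a = u b - u a" for a b by (metis diff_diff_eq2 add_diff_cancel_left' diff_add_cancel diff_diff_add diff_eq_eq)
  then show ?thesis using G unfolding primitive_def by simp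
qed

section \<open>Bounded solutions of the Riccati equation\<close>

lemma continuous_lebesgue_measurable:
  fixes f :: "real \<Rightarrow> real"
  assumes "continuous_on UNIV f" shows "f \<in> borel_measurable lebesgue"
  by (rule measurable_completion) (simp add: borel_measurable_continuous_onI assms)

lemma exp_integral_atMost:
  fixes k :: real assumes "k > 0"
  shows "(\<lambda>t. exp (k * t)) absolutely_integrable_on {..x}" "integral {..x} (\<lambda>t. exp (k * t)) = exp (k * x) / k"
proof -
  have h: "((\<lambda>t. exp (- k * t)) has_integral exp (- k * (- x)) / k) {- x..}"
    by (rule has_integral_exp_minus_to_infinity[OF assms])
  then have "(\<lambda>t. exp (- k * t)) absolutely_integrable_on {- x..}"
    by (intro nonnegative_absolutely_integrable_1) (auto simp: integrable_on_def)
  moreover from h have "integral {- x..} (\<lambda>t. exp (- k * t)) = exp (k * x) / k"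
    by (simp add: integral_unique)
  ultimately have "(\<lambda>t. exp (- k * (- t))) absolutely_integrable_on {..x} \<and>
      integral {..x} (\<lambda>t. exp (- k * (- t))) = exp (k * x) / k"
    by (subst has_absolute_integral_reflect_real[where B="{- x..}"]) auto
  then show "(\<lambda>t. exp (k * t)) absolutely_integrable_on {..x}" "integral {..x} (\<lambda>t. exp (k * t)) = exp (k * x) / k"
    by auto
qed

text \<open>This is the operator \<open>(d/dx + k)\<^bsup>-1\<^esup>\<close> on bounded functions: it picks the only bounded solution \<open>r\<close> of
  \<open>r' + k r = q\<close>.\<close>

definition resolvent :: "real \<Rightarrow> (real \<Rightarrow> real) \<Rightarrow> real \<Rightarrow> real" where
  "resolvent k q x = exp (- k * x) * integral {..x} (\<lambda>t. exp (k * t) * q t)"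

lemma resolvent_integrable:
  fixes k :: real
  assumes "k > 0" "q \<in> borel_measurable lebesgue" "\<And>t. \<bar>q t\<bar> \<le> C"
  shows "(\<lambda>t. exp (k * t) * q t) absolutely_integrable_on {..x}"
proof (rule measurable_bounded_by_integrable_imp_absolutely_integrable)
  have "(\<lambda>t. exp (k * t)) \<in> borel_measurable lebesgue"
    by (intro continuous_lebesgue_measurable continuous_intros)
  then have "(\<lambda>t. exp (k * t) * q t) \<in> borel_measurable lebesgue"
    using assms(2) by (rule borel_measurable_times)
  then show "(\<lambda>t. exp (k * t) * q t) \<in> borel_measurable (lebesgue_on {..x})"
    by (rule measurable_restrict_space1)
  show "(\<lambda>t. exp (k * t) * C) integrable_on {..x}"
    using exp_integral_atMost(1)[OF assms(1), of x]
    by (intro integrable_on_mult_left) (simp add: absolutely_integrable_on_def)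
  show "norm (exp (k * t) * q t) \<le> exp (k * t) * C" for t
    using assms(3)[of t] by (simp add: abs_mult)
qed simp

text \<open>The kernel \<open>t \<mapsto> exp (- k (x - t))\<close> of the resolvent is positive with mass \<open>1 / k\<close>.\<close>

lemma resolvent_bounds:
  fixes k :: real
  assumes k: "k > 0" and m: "q \<in> borel_measurable lebesgue" and q: "\<And>t. l \<le> q t" "\<And>t. q t \<le> u"
  shows "l / k \<le> resolvent k q x" "resolvent k q x \<le> u / k"
proof -
  have b: "\<bar>q t\<bar> \<le> max \<bar>l\<bar> \<bar>u\<bar>" for t using q[of t] by auto
  have qi: "(\<lambda>t. exp (k * t) * q t) integrable_on {..x}"
    using resolvent_integrable[OF k m b] by (simp add: absolutely_integrable_on_def)
  have ei: "(\<lambda>t. exp (k * t)) integrable_on {..x}"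
    using exp_integral_atMost(1)[OF k, of x] by (simp add: absolutely_integrable_on_def)
  have c: "integral {..x} (\<lambda>t. exp (k * t) * c) = exp (k * x) * (c / k)" for c
    using exp_integral_atMost(2)[OF k, of x] by simp
  have "exp (k * x) * (l / k) \<le> integral {..x} (\<lambda>t. exp (k * t) * q t)"
    unfolding c[symmetric]
    by (rule integral_le[OF integrable_on_mult_left[OF ei] qi]) (simp add: q)
  then have "exp (- k * x) * (exp (k * x) * (l / k)) \<le> resolvent k q x"
    unfolding resolvent_def by (rule mult_left_mono) simp
  then show "l / k \<le> resolvent k q x" by (simp add: mult_exp_exp flip: mult.assoc)
  have "integral {..x} (\<lambda>t. exp (k * t) * q t) \<le> exp (k * x) * (u / k)"
    unfolding c[symmetric]
    by (rule integral_le[OF qi integrable_on_mult_left[OF ei]]) (simp add: q)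
  then have "resolvent k q x \<le> exp (- k * x) * (exp (k * x) * (u / k))"
    unfolding resolvent_def by (rule mult_left_mono) simp
  then show "resolvent k q x \<le> u / k" by (simp add: mult_exp_exp flip: mult.assoc)
qed

lemma resolvent_diff:
  fixes k :: real
  assumes k: "k > 0" and m: "q \<in> borel_measurable lebesgue" "r \<in> borel_measurable lebesgue"
    and b: "\<And>t. \<bar>q t\<bar> \<le> C" "\<And>t. \<bar>r t\<bar> \<le> C"
  shows "resolvent k (\<lambda>t. q t - r t) x = resolvent k q x - resolvent k r x"
proof -
  have "integral {..x} (\<lambda>t. exp (k * t) * q t - exp (k * t) * r t) =
    integral {..x} (\<lambda>t. exp (k * t) * q t) - integral {..x} (\<lambda>t. exp (k * t) * r t)"
    using resolvent_integrable[OF k m(1) b(1)] resolvent_integrable[OF k m(2) b(2)]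
    by (intro Henstock_Kurzweil_Integration.integral_diff) (auto simp: absolutely_integrable_on_def)
  then show ?thesis by (simp add: resolvent_def right_diff_distrib)
qed

lemma resolvent_primitive:
  fixes k :: real
  assumes k: "k > 0" and m: "q \<in> borel_measurable lebesgue" and b: "\<And>t. \<bar>q t\<bar> \<le> C"
  shows "primitive (resolvent k q) (\<lambda>x. q x - k * resolvent k q x)"
proof -
  let ?h = "\<lambda>t. exp (k * t) * q t"
  define G where "G = (\<lambda>x. integral {..x} ?h)"
  note hi = resolvent_integrable[OF k m b]
  have G: "primitive G ?h"
    unfolding primitive_def
  proof (intro allI impI conjI)
    fix a b :: real assume ab: "a \<le> b"
    show hab: "?h absolutely_integrable_on {a..b}"
      by (rule set_integrable_subset[OF hi[of b]]) auto
    have "(?h has_integral G a + integral {a..b} ?h) ({..a} \<union> {a..b})"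
    proof (rule has_integral_Un)
      show "(?h has_integral G a) {..a}"
        unfolding G_def using hi[of a] by (auto simp: absolutely_integrable_on_def)
      show "(?h has_integral integral {a..b} ?h) {a..b}"
        using hab by (auto simp: absolutely_integrable_on_def)
      have "{..a} \<inter> {a..b} = {a}" using ab by auto
      then show "negligible ({..a} \<inter> {a..b})" by simp
    qed
    moreover have "{..a} \<union> {a..b} = {..b}" using ab by auto
    ultimately have "G b = G a + integral {a..b} ?h" by (simp add: G_def integral_unique)
    then show "integral {a..b} ?h = G b - G a" by simp
  qed
  have E: "primitive (\<lambda>x. exp (- k * x)) (\<lambda>x. - k * exp (- k * x))"
    by (rule primitive_of_derivative) (auto intro!: derivative_eq_intros continuous_intros)
  have "primitive (\<lambda>x. exp (- k * x) * G x) (\<lambda>x. - k * exp (- k * x) * G x + exp (- k * x) * (exp (k * x) * q x))"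
    by (rule primitive_mult[OF E G])
  moreover have "(\<lambda>x. exp (- k * x) * G x) = resolvent k q" by (simp add: G_def resolvent_def fun_eq_iff)
  moreover have "- k * exp (- k * x) * G x + exp (- k * x) * (exp (k * x) * q x) = q x - k * resolvent k q x" for x
  proof -
    have "exp (- k * x) * (exp (k * x) * q x) = q x" by (simp add: mult_exp_exp flip: mult.assoc)
    then show ?thesis by (simp add: G_def resolvent_def)
  qed
  ultimately show ?thesis by simp
qed

text \<open>Adding \<open>2 c m\<close> to both sides of \<open>m' = W - m\<^sup>2\<close> turns the equation into the fixed point problem
  \<open>m = resolvent (2 c) (Q m)\<close> with \<open>Q m = W + 2 c m - m\<^sup>2\<close>. The function \<open>y \<mapsto> 2 c y - y\<^sup>2\<close> increases on
  \<open>[s, c]\<close> with slope between \<open>0\<close> and \<open>2 (c - s)\<close>. With \<open>s\<^sup>2 \<le> W \<le> c\<^sup>2\<close> it follows that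
  \<open>2 c s \<le> Q m \<le> 2 c\<^sup>2\<close>, so the map preserves the bounds \<open>s \<le> m \<le> c\<close>, and it
  contracts the supremum norm by the factor \<open>(c - s) / c < 1\<close>. So Banach's theorem yields a solution
  on the whole line at once, although \<open>W\<close> is merely measurable.\<close>

theorem riccati_positive_solution:
  fixes W :: "real \<Rightarrow> real"
  assumes W: "W \<in> borel_measurable lebesgue" "\<And>x. s\<^sup>2 \<le> W x" "\<And>x. W x \<le> c\<^sup>2"
    and s: "0 < s" "s \<le> c"
  shows "\<exists>m. primitive m (\<lambda>x. W x - (m x)\<^sup>2) \<and> (\<forall>x. s \<le> m x \<and> m x \<le> c)"
proof -
  define Q where "Q = (\<lambda>f :: real \<Rightarrow> real. \<lambda>x. W x + 2 * c * f x - (f x)\<^sup>2)"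
  define S :: "(real \<Rightarrow>\<^sub>C real) set" where "S = PiC UNIV (\<lambda>_. {s..c})"
  have S: "f \<in> S \<longleftrightarrow> (\<forall>x. s \<le> f x \<and> f x \<le> c)" for f
    by (auto simp: S_def mem_PiC_iff)
  have c: "c > 0" and k: "2 * c > 0" using s by auto
  have Qm: "Q f \<in> borel_measurable lebesgue" for f :: "real \<Rightarrow>\<^sub>C real"
  proof -
    have "apply_bcontfun f \<in> borel_measurable lebesgue"
      by (rule continuous_lebesgue_measurable) simp
    then show ?thesis unfolding Q_def
      by (intro borel_measurable_diff borel_measurable_add borel_measurable_times borel_measurable_power
          borel_measurable_const W(1))
  qed
  have Ql: "2 * c * s \<le> Q f x" and Qu: "Q f x \<le> 2 * c * c" if "f \<in> S" for f x
  proof -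
    have f: "s \<le> f x" "f x \<le> c" using that S by auto
    have "0 \<le> (f x - s) * (2 * c - f x - s)" using f by (intro mult_nonneg_nonneg) auto
    then show "2 * c * s \<le> Q f x" using W(2)[of x] by (simp add: Q_def power2_eq_square algebra_simps)
    have "0 \<le> (c - f x)\<^sup>2" by simp
    then show "Q f x \<le> 2 * c * c" using W(3)[of x] by (simp add: Q_def power2_eq_square algebra_simps)
  qed
  have Qb: "\<bar>Q f x\<bar> \<le> 2 * c * c" if "f \<in> S" for f x
    using Ql[OF that, of x] Qu[OF that, of x] mult_pos_pos[OF k s(1)] by (simp add: abs_le_iff)
  define T where "T = (\<lambda>f :: real \<Rightarrow>\<^sub>C real. Bcontfun (resolvent (2 * c) (Q f)))"
  have R: "s \<le> resolvent (2 * c) (Q f) x" "resolvent (2 * c) (Q f) x \<le> c" if "f \<in> S" for f x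
    using resolvent_bounds[OF k Qm Ql[OF that] Qu[OF that], of x] c by auto
  have RP: "primitive (resolvent (2 * c) (Q f)) (\<lambda>x. Q f x - 2 * c * resolvent (2 * c) (Q f) x)" if "f \<in> S" for f
    by (rule resolvent_primitive[OF k Qm Qb[OF that]])
  have T: "apply_bcontfun (T f) = resolvent (2 * c) (Q f)" if "f \<in> S" for f
  proof -
    have "norm (resolvent (2 * c) (Q f) x) \<le> c" for x
      using R[OF that, of x] s(1) by simp
    then have "resolvent (2 * c) (Q f) \<in> bcontfun"
      by (rule bcontfun_normI[OF primitive_continuous[OF RP[OF that]]])
    then show ?thesis unfolding T_def by (rule Bcontfun_inverse)
  qed
  have "\<exists>!f\<in>S. T f = f"
  proof (rule Banach_fix)
    show "complete S" unfolding S_def complete_eq_closed by (rule closed_PiC) simp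
    have "const_bcontfun s \<in> S" using s by (simp add: S const_bcontfun.rep_eq)
    then show "S \<noteq> {}" by blast
    show "0 \<le> 1 - s / c" "1 - s / c < 1" using s c by (auto simp: field_simps)
    show "T ` S \<subseteq> S" using R T by (auto simp: S)
    fix f g assume f: "f \<in> S" and g: "g \<in> S"
    let ?d = "dist f g"
    have Qd: "\<bar>Q f x - Q g x\<bar> \<le> (2 * c - 2 * s) * ?d" for x
    proof -
      have e: "Q f x - Q g x = (f x - g x) * (2 * c - f x - g x)"
        by (simp add: Q_def power2_eq_square algebra_simps)
      have "\<bar>f x - g x\<bar> \<le> ?d" using dist_bounded[of f x g] by (simp add: dist_real_def)
      moreover have "\<bar>2 * c - f x - g x\<bar> \<le> 2 * c - 2 * s"
        using f g unfolding S by (smt (verit, best))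
      ultimately have "\<bar>f x - g x\<bar> * \<bar>2 * c - f x - g x\<bar> \<le> ?d * (2 * c - 2 * s)"
        by (intro mult_mono) auto
      then show ?thesis unfolding e abs_mult by (simp add: mult.commute)
    qed
    show "dist (T f) (T g) \<le> (1 - s / c) * ?d"
    proof (rule dist_bound)
      fix x
      have "resolvent (2 * c) (\<lambda>t. Q f t - Q g t) x = T f x - T g x"
        unfolding T[OF f] T[OF g] by (rule resolvent_diff[OF k Qm Qm Qb[OF f] Qb[OF g]])
      moreover have "- ((2 * c - 2 * s) * ?d) / (2 * c) \<le> resolvent (2 * c) (\<lambda>t. Q f t - Q g t) x"
        by (rule resolvent_bounds(1)[OF k borel_measurable_diff[OF Qm Qm], where u="(2 * c - 2 * s) * ?d"])
          (use Qd in \<open>smt (verit)\<close>)+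
      moreover have "resolvent (2 * c) (\<lambda>t. Q f t - Q g t) x \<le> ((2 * c - 2 * s) * ?d) / (2 * c)"
        by (rule resolvent_bounds(2)[OF k borel_measurable_diff[OF Qm Qm], where l="- ((2 * c - 2 * s) * ?d)"])
          (use Qd in \<open>smt (verit)\<close>)+
      moreover have "((2 * c - 2 * s) * ?d) / (2 * c) = (1 - s / c) * ?d"
        using c by (simp add: field_simps)
      ultimately show "dist (T f x) (T g x) \<le> (1 - s / c) * ?d"
        by (simp add: dist_real_def abs_le_iff)
    qed
  qed
  then obtain f where f: "f \<in> S" "T f = f" by blast
  have fx: "resolvent (2 * c) (Q f) = apply_bcontfun f" using T[OF f(1)] f(2) by simp
  have "primitive f (\<lambda>x. W x - (f x)\<^sup>2)"
    using RP[OF f(1)] unfolding fx by (simp add: Q_def)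
  with f(1) show ?thesis unfolding S by blast
qed

text \<open>Reflecting the line and changing sign preserves the form of the Riccati equation.\<close>

lemma riccati_negative_solution:
  fixes W :: "real \<Rightarrow> real"
  assumes W: "W \<in> borel_measurable lebesgue" "\<And>x. s\<^sup>2 \<le> W x" "\<And>x. W x \<le> c\<^sup>2"
    and s: "0 < s" "s \<le> c"
  shows "\<exists>m. primitive m (\<lambda>x. W x - (m x)\<^sup>2) \<and> (\<forall>x. - c \<le> m x \<and> m x \<le> - s)"
proof -
  have "(\<lambda>x. W (- x)) \<in> borel_measurable lebesgue"
    using measurable_compose[OF lebesgue_measurable_scaling[of "-1 :: real"] W(1)] by simp
  from riccati_positive_solution[OF this W(2,3) s]
  obtain n where n: "primitive n (\<lambda>x. W (- x) - (n x)\<^sup>2)" "\<And>x. s \<le> n x \<and> n x \<le> c" by blast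
  have "primitive (\<lambda>x. - n (- x)) (\<lambda>x. W x - (- n (- x))\<^sup>2)"
    using primitive_reflect[OF n(1)] by simp
  with n(2) show ?thesis by (intro exI[of _ "\<lambda>x. - n (- x)"]) auto
qed

section \<open>Energy on half-lines\<close>

lemma absolutely_integrable_UNIV_iff: "f absolutely_integrable_on UNIV \<longleftrightarrow> integrable lebesgue f" for f :: "real \<Rightarrow> real"
  by (simp add: set_integrable_def)

lemma integrable_imp_absolutely_integrable_on:
  fixes f :: "real \<Rightarrow> real"
  assumes "integrable lebesgue f" "S \<in> sets lebesgue"
  shows "f absolutely_integrable_on S"
  using set_integrable_subset[of lebesgue UNIV f S] assms by (simp add: absolutely_integrable_UNIV_iff)

lemma integrable_imp_integrable_on:
  fixes f :: "real \<Rightarrow> real"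
  assumes "integrable lebesgue f" "S \<in> sets lebesgue"
  shows "f integrable_on S"
  using integrable_imp_absolutely_integrable_on[OF assms] by (simp add: absolutely_integrable_on_def)

lemma L2_mult_integrable:
  assumes "f \<in> L2" "g \<in> L2" shows "integrable lebesgue (\<lambda>x. f x * g x)"
proof (rule Bochner_Integration.integrable_bound)
  show "integrable lebesgue (\<lambda>x. (f x)\<^sup>2 + (g x)\<^sup>2)"
    using assms unfolding L2_def by (auto intro!: Bochner_Integration.integrable_add)
  show "(\<lambda>x. f x * g x) \<in> borel_measurable lebesgue"
    using assms unfolding L2_def by (auto intro!: borel_measurable_times)
  have "\<bar>a * b\<bar> \<le> a\<^sup>2 + b\<^sup>2" for a b :: real
  proof -
    have "0 \<le> (\<bar>a\<bar> - \<bar>b\<bar>)\<^sup>2" by simp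
    then have "2 * (\<bar>a\<bar> * \<bar>b\<bar>) \<le> a\<^sup>2 + b\<^sup>2" by (simp add: power2_diff)
    moreover have "0 \<le> \<bar>a\<bar> * \<bar>b\<bar>" by simp
    ultimately show ?thesis unfolding abs_mult by linarith
  qed
  then show "AE x in lebesgue. norm (f x * g x) \<le> norm ((f x)\<^sup>2 + (g x)\<^sup>2)"
    by (intro AE_I2) simp
qed

lemma integrable_bounded_times:
  fixes f b :: "real \<Rightarrow> real"
  assumes "integrable lebesgue f" "b \<in> borel_measurable lebesgue" "\<And>x. \<bar>b x\<bar> \<le> C"
  shows "integrable lebesgue (\<lambda>x. b x * f x)"
proof (rule Bochner_Integration.integrable_bound)
  show "integrable lebesgue (\<lambda>x. C * f x)" using assms(1) by simp
  show "(\<lambda>x. b x * f x) \<in> borel_measurable lebesgue"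
    using assms by (intro borel_measurable_times) auto
  have "\<bar>b x * f x\<bar> \<le> \<bar>C * f x\<bar>" for x
    unfolding abs_mult using assms(3)[of x] by (intro mult_right_mono) auto
  then show "AE x in lebesgue. norm (b x * f x) \<le> norm (C * f x)" by (intro AE_I2) simp
qed

lemma integrable_limit_at_top_zero:
  fixes h :: "real \<Rightarrow> real"
  assumes h: "integrable lebesgue h" and lim: "(h \<longlongrightarrow> l) at_top"
  shows "l = 0"
proof (rule ccontr)
  assume "l \<noteq> 0"
  then have e: "\<bar>l\<bar> / 2 > 0" by simp
  have "\<forall>\<^sub>F x in at_top. \<bar>h x - l\<bar> < \<bar>l\<bar> / 2"
    using tendstoD[OF lim e] by (simp add: dist_real_def)
  then obtain B where "\<And>x. x \<ge> B \<Longrightarrow> \<bar>h x - l\<bar> < \<bar>l\<bar> / 2"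
    unfolding eventually_at_top_linorder by blast
  then have B: "\<bar>l\<bar> / 2 \<le> \<bar>h x\<bar>" if "x \<ge> B" for x using that by (smt (verit, best) field_sum_of_halves)
  have hi: "integrable lebesgue (\<lambda>x. \<bar>h x\<bar>)" using h by simp
  have "real n * (\<bar>l\<bar> / 2) \<le> integral UNIV (\<lambda>x. \<bar>h x\<bar>)" for n :: nat
  proof -
    have "real n * (\<bar>l\<bar> / 2) = integral {B..B + real n} (\<lambda>_. \<bar>l\<bar> / 2)" by simp
    also have "\<dots> \<le> integral {B..B + real n} (\<lambda>x. \<bar>h x\<bar>)"
    proof (rule integral_le)
      show "(\<lambda>x. \<bar>h x\<bar>) integrable_on {B..B + real n}" by (rule integrable_imp_integrable_on[OF hi]) simp
      show "(\<lambda>_. \<bar>l\<bar> / 2) integrable_on {B..B + real n}" by (rule integrable_const_ivl)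
    qed (use B in simp_all)
    also have "\<dots> \<le> integral UNIV (\<lambda>x. \<bar>h x\<bar>)"
      by (rule integral_subset_le) (auto intro: integrable_imp_integrable_on[OF hi])
    finally show ?thesis .
  qed
  moreover obtain n :: nat where "integral UNIV (\<lambda>x. \<bar>h x\<bar>) / (\<bar>l\<bar> / 2) < real n"
    using reals_Archimedean2 by blast
  ultimately show False using e by (metis not_less pos_divide_less_eq)
qed

text \<open>As \<open>b \<longrightarrow> \<infinity>\<close>, \<open>h b - h a\<close> tends to the integral of \<open>k\<close>, so \<open>h\<close> has a limit. That limit is zero because \<open>h\<close> is
  integrable.\<close>

lemma primitive_integral_atLeast:
  assumes p: "primitive h k" and hi: "integrable lebesgue h" and ki: "integrable lebesgue k"
  shows "integral {a..} k = - h a"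
proof -
  have ka: "k absolutely_integrable_on {a..}" by (rule integrable_imp_absolutely_integrable_on[OF ki]) simp
  have "((\<lambda>b. LINT x:{a..b}|lebesgue. k x) \<longlongrightarrow> (LINT x:{a..}|lebesgue. k x)) at_top"
    by (rule tendsto_set_lebesgue_integral_at_top[OF _ ka]) simp
  then have "((\<lambda>b. LINT x:{a..b}|lebesgue. k x) \<longlongrightarrow> integral {a..} k) at_top"
    using set_lebesgue_integral_eq_integral(2)[OF ka] by simp
  then have "((\<lambda>b. h b - h a) \<longlongrightarrow> integral {a..} k) at_top"
  proof (rule Lim_transform_eventually)
    show "\<forall>\<^sub>F b in at_top. (LINT x:{a..b}|lebesgue. k x) = h b - h a"
      unfolding eventually_at_top_linorder
      by (intro exI[of _ a] allI impI)
        (simp add: set_lebesgue_integral_eq_integral(2)[OF primitiveD(1)[OF p]] primitiveD(2)[OF p])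
  qed
  then have "((\<lambda>b. h b - h a + h a) \<longlongrightarrow> integral {a..} k + h a) at_top"
    by (intro tendsto_intros)
  then have "(h \<longlongrightarrow> integral {a..} k + h a) at_top" by simp
  from integrable_limit_at_top_zero[OF hi this] show ?thesis by simp
qed

lemma integral_reflect_half_line:
  fixes f :: "real \<Rightarrow> real"
  assumes "integrable lebesgue f"
  shows "integrable lebesgue (\<lambda>x. f (- x))" "integral {- a..} (\<lambda>x. f (- x)) = integral {..a} f"
proof -
  have "f absolutely_integrable_on UNIV \<and> integral UNIV f = integral UNIV f"
    using assms by (simp add: absolutely_integrable_UNIV_iff)
  then have "(\<lambda>x. f (- x)) absolutely_integrable_on UNIV"
    using has_absolute_integral_reflect_real[of UNIV UNIV f "integral UNIV f"] by auto
  then show "integrable lebesgue (\<lambda>x. f (- x))" by (simp add: absolutely_integrable_UNIV_iff)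
  have "f absolutely_integrable_on {..a} \<and> integral {..a} f = integral {..a} f"
    using integrable_imp_absolutely_integrable_on[OF assms] by simp
  then show "integral {- a..} (\<lambda>x. f (- x)) = integral {..a} f"
    using has_absolute_integral_reflect_real[of "{- a..}" "{..a}" f "integral {..a} f"] by auto
qed

lemma primitive_integral_atMost:
  assumes p: "primitive h k" and hi: "integrable lebesgue h" and ki: "integrable lebesgue k"
  shows "integral {..a} k = h a"
proof -
  have "integral {- a..} (\<lambda>x. k (- x)) = - (- h (- (- a)))"
    by (rule primitive_integral_atLeast[OF primitive_reflect[OF p]])
      (intro integrable_minus integral_reflect_half_line hi ki)+
  then show ?thesis using integral_reflect_half_line(2)[OF ki] by simp
qed

text \<open>Completing the square. If \<open>m' = W - m\<^sup>2\<close> then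
  \<open>(m w\<^sup>2)' = (W - m\<^sup>2) w\<^sup>2 + 2 m w w' = (w'\<^sup>2 + W w\<^sup>2) - (w' - m w)\<^sup>2\<close>, so on a half-line the energy is a
  nonnegative square plus a boundary term. The boundary term at infinity vanishes because \<open>m w\<^sup>2\<close> is
  integrable.\<close>

lemma riccati_energy:
  fixes W m w g :: "real \<Rightarrow> real"
  assumes m: "primitive m (\<lambda>x. W x - (m x)\<^sup>2)" and mb: "\<And>x. \<bar>m x\<bar> \<le> C"
    and W: "W \<in> borel_measurable lebesgue" "\<And>x. \<bar>W x\<bar> \<le> B"
    and w: "primitive w g" "w \<in> L2" "g \<in> L2"
  shows "integrable lebesgue (\<lambda>x. (g x)\<^sup>2 + W x * (w x)\<^sup>2)" (is ?E)
    and "integrable lebesgue (\<lambda>x. (g x - m x * w x)\<^sup>2)" (is ?D)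
    and "integral {a..} (\<lambda>x. (g x)\<^sup>2 + W x * (w x)\<^sup>2) =
      integral {a..} (\<lambda>x. (g x - m x * w x)\<^sup>2) - m a * (w a)\<^sup>2" (is ?R)
    and "integral {..a} (\<lambda>x. (g x)\<^sup>2 + W x * (w x)\<^sup>2) =
      integral {..a} (\<lambda>x. (g x - m x * w x)\<^sup>2) + m a * (w a)\<^sup>2" (is ?L)
proof -
  have mm: "m \<in> borel_measurable lebesgue"
    by (rule continuous_lebesgue_measurable[OF primitive_continuous[OF m]])
  have w2: "integrable lebesgue (\<lambda>x. (w x)\<^sup>2)" and g2: "integrable lebesgue (\<lambda>x. (g x)\<^sup>2)"
    using w(2,3) by (auto simp: L2_def)
  have gw: "integrable lebesgue (\<lambda>x. w x * g x)" by (rule L2_mult_integrable[OF w(2,3)])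
  have mgw: "integrable lebesgue (\<lambda>x. m x * (w x * g x))"
    by (rule integrable_bounded_times[OF gw mm mb])
  have mw: "integrable lebesgue (\<lambda>x. m x * (w x)\<^sup>2)"
    by (rule integrable_bounded_times[OF w2 mm mb])
  have mmw: "integrable lebesgue (\<lambda>x. m x * (m x * (w x)\<^sup>2))"
    by (rule integrable_bounded_times[OF mw mm mb])
  show E: ?E
    by (intro Bochner_Integration.integrable_add g2 integrable_bounded_times[OF w2 W])
  have "integrable lebesgue (\<lambda>x. (g x)\<^sup>2 - 2 * (m x * (w x * g x)) + m x * (m x * (w x)\<^sup>2))"
    by (intro Bochner_Integration.integrable_add Bochner_Integration.integrable_diff
        Bochner_Integration.integrable_mult_right g2 mgw mmw)
  then show D: ?D by (simp add: power2_eq_square algebra_simps)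
  let ?k = "\<lambda>x. ((g x)\<^sup>2 + W x * (w x)\<^sup>2) - (g x - m x * w x)\<^sup>2"
  have k: "integrable lebesgue ?k" by (intro Bochner_Integration.integrable_diff E D)
  have "primitive (\<lambda>x. m x * (w x * w x)) (\<lambda>x. (W x - (m x)\<^sup>2) * (w x * w x) + m x * (g x * w x + w x * g x))"
    by (intro primitive_mult m w)
  moreover have "(\<lambda>x. (W x - (m x)\<^sup>2) * (w x * w x) + m x * (g x * w x + w x * g x)) = ?k"
    by (simp add: fun_eq_iff power2_eq_square algebra_simps)
  ultimately have p: "primitive (\<lambda>x. m x * (w x)\<^sup>2) ?k" by (simp add: power2_eq_square)
  have split: "integral S ?k = integral S (\<lambda>x. (g x)\<^sup>2 + W x * (w x)\<^sup>2) - integral S (\<lambda>x. (g x - m x * w x)\<^sup>2)"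
    if "S \<in> sets lebesgue" for S
    by (intro Henstock_Kurzweil_Integration.integral_diff integrable_imp_integrable_on E D that)
  show ?R using primitive_integral_atLeast[OF p mw k, of a] split[of "{a..}"] by simp
  show ?L using primitive_integral_atMost[OF p mw k, of a] split[of "{..a}"] by simp
qed

lemma integral_split_at:
  fixes f :: "real \<Rightarrow> real"
  assumes "integrable lebesgue f"
  shows "integral UNIV f = integral {..a} f + integral {a..} f"
proof -
  have "(f has_integral integral {..a} f + integral {a..} f) ({..a} \<union> {a..})"
  proof (rule has_integral_Un)
    show "(f has_integral integral {..a} f) {..a}" "(f has_integral integral {a..} f) {a..}"
      using integrable_imp_integrable_on[OF assms] by (auto simp: has_integral_integral)
    have "{..a} \<inter> {a..} = {a}" by auto
    then show "negligible ({..a} \<inter> {a..})" by simp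
  qed
  moreover have "{..a} \<union> {a..} = UNIV" by auto
  ultimately show ?thesis by (simp add: integral_unique)
qed

lemma integral_power2_nonneg: "0 \<le> integral S (\<lambda>x. (f x)\<^sup>2)" for f :: "real \<Rightarrow> real"
  by (cases "(\<lambda>x. (f x)\<^sup>2) integrable_on S")
    (simp_all add: Henstock_Kurzweil_Integration.integral_nonneg not_integrable_integral)

lemma integral_zero_imp_AE:
  fixes f :: "real \<Rightarrow> real"
  assumes f: "integrable lebesgue f" "\<And>x. 0 \<le> f x" and S: "S \<in> sets lebesgue" "integral S f = 0"
  shows "AE x in lebesgue. x \<in> S \<longrightarrow> f x = 0"
proof -
  have a: "f absolutely_integrable_on S" by (rule integrable_imp_absolutely_integrable_on[OF f(1) S(1)])
  have "(LINT x|lebesgue. indicator S x *\<^sub>R f x) = 0"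
    using set_lebesgue_integral_eq_integral(2)[OF a] S(2) unfolding set_lebesgue_integral_def by simp
  moreover have "integrable lebesgue (\<lambda>x. indicator S x *\<^sub>R f x)"
    using a unfolding set_integrable_def .
  ultimately have "AE x in lebesgue. indicator S x *\<^sub>R f x = 0"
    using f(2) integral_nonneg_eq_0_iff_AE[of lebesgue "\<lambda>x. indicator S x *\<^sub>R f x"] by simp
  then show ?thesis by eventually_elim (simp add: indicator_def)
qed

text \<open>\<open>w exp (- M)\<close> has almost everywhere derivative \<open>(g - m w) exp (- M) = 0\<close>.\<close>

lemma linear_ode_unique:
  assumes w: "primitive w g" and M: "\<And>x. (M has_real_derivative m x) (at x)" "continuous_on UNIV m"
    and z: "AE x in lebesgue. x \<in> {a..b} \<longrightarrow> g x = m x * w x" and ab: "a \<le> b"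
  shows "w b * exp (- M b) = w a * exp (- M a)"
proof -
  have cM: "continuous_on UNIV M" using M(1) by (meson DERIV_continuous_on has_field_derivative_at_within)
  have "primitive (\<lambda>x. exp (- M x)) (\<lambda>x. exp (- M x) * - m x)"
    by (rule primitive_of_derivative) (auto intro!: derivative_eq_intros M continuous_intros cM)
  from primitive_mult[OF w this]
  have p: "primitive (\<lambda>x. w x * exp (- M x)) (\<lambda>x. g x * exp (- M x) + w x * (exp (- M x) * - m x))" .
  from z obtain N where N: "N \<in> null_sets lebesgue" "\<And>x. x \<notin> N \<Longrightarrow> x \<in> {a..b} \<Longrightarrow> g x = m x * w x"
    by (auto elim!: AE_E3)
  have "integral {a..b} (\<lambda>x. g x * exp (- M x) + w x * (exp (- M x) * - m x)) = integral {a..b} (\<lambda>_. 0)"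
    by (rule integral_spike[of N]) (use N in \<open>auto simp: negligible_iff_null_sets\<close>)
  then show ?thesis using primitiveD(2)[OF p ab] by simp
qed

lemma exp_abs_integrable:
  fixes k :: real assumes "k > 0"
  shows "integrable lebesgue (\<lambda>x. exp (- k * \<bar>x - a\<bar>))"
proof -
  let ?f = "\<lambda>x. exp (- k * \<bar>x - a\<bar>)"
  have "(\<lambda>t. exp (- k * a) * exp (k * t)) absolutely_integrable_on {..a}"
    using exp_integral_atMost(1)[OF assms, of a] by simp
  moreover have "exp (- k * a) * exp (k * t) = ?f t" if "t \<in> {..a}" for t
    using that by (simp add: mult_exp_exp algebra_simps)
  ultimately have L: "?f absolutely_integrable_on {..a}"
    using absolutely_integrable_cong[of "{..a}" "\<lambda>t. exp (- k * a) * exp (k * t)" ?f] by blast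
  have "(\<lambda>t. exp (- k * t)) absolutely_integrable_on {a..}"
    by (rule nonnegative_absolutely_integrable_1[OF integrable_on_exp_minus_to_infinity[OF assms]]) simp
  then have "(\<lambda>t. exp (k * a) * exp (- k * t)) absolutely_integrable_on {a..}" by simp
  moreover have "exp (k * a) * exp (- k * t) = ?f t" if "t \<in> {a..}" for t
    using that by (simp add: mult_exp_exp algebra_simps)
  ultimately have R: "?f absolutely_integrable_on {a..}"
    using absolutely_integrable_cong[of "{a..}" "\<lambda>t. exp (k * a) * exp (- k * t)" ?f] by blast
  have "?f absolutely_integrable_on ({..a} \<union> {a..})"
    by (rule set_integrable_Un[OF L R]) auto
  moreover have "{..a} \<union> {a..} = UNIV" by auto
  ultimately show ?thesis by (simp add: absolutely_integrable_UNIV_iff)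
qed

lemma AE_open_complement:
  assumes "open S" "AE x in lebesgue. x \<notin> S" shows "S = {}"
proof -
  from assms(2) obtain N where "N \<in> null_sets lebesgue" "S \<subseteq> N" by (elim AE_E3) auto
  then have "negligible S" using negligible_iff_null_sets negligible_subset by blast
  with open_not_negligible[OF assms(1)] show ?thesis by blast
qed

lemma Linf_norm_eq_1:
  assumes "continuous_on UNIV u" "\<And>x. \<bar>u x\<bar> \<le> 1" "u a = 1"
  shows "Linf_norm u = 1"
proof (rule antisym)
  let ?e = "esssup lebesgue (\<lambda>x. ereal \<bar>u x\<bar>)"
  have um: "u \<in> borel_measurable lebesgue" by (rule continuous_lebesgue_measurable[OF assms(1)])
  show "Linf_norm u \<le> 1" unfolding Linf_norm_def
    by (rule esssup_I) (use um assms(2) in \<open>auto simp: one_ereal_def\<close>)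
  show "1 \<le> Linf_norm u"
  proof (rule ccontr)
    assume "\<not> 1 \<le> Linf_norm u"
    then have less: "?e < ereal \<bar>u a\<bar>" by (simp add: Linf_norm_def assms(3) one_ereal_def not_le)
    have "open {x. ?e < ereal \<bar>u x\<bar>}"
      using assms(1) by (intro open_Collect_less continuous_intros) auto
    moreover have "AE x in lebesgue. x \<notin> {x. ?e < ereal \<bar>u x\<bar>}"
      using esssup_AE[of "\<lambda>x. ereal \<bar>u x\<bar>" lebesgue] by eventually_elim (simp add: not_less)
    ultimately have "{x. ?e < ereal \<bar>u x\<bar>} = {}" by (rule AE_open_complement)
    with less show False by blast
  qed
qed

lemma LinfI:
  assumes "f \<in> borel_measurable lebesgue" "AE x in lebesgue. \<bar>f x\<bar> \<le> C"
  shows "f \<in> Linf"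
proof -
  have "Linf_norm f \<le> ereal C" unfolding Linf_norm_def
    by (rule esssup_I) (use assms in auto)
  then have "Linf_norm f < \<infinity>" by (rule le_less_trans) simp
  with assms(1) show ?thesis by (simp add: Linf_def)
qed

lemma Linf_locI:
  assumes "f \<in> borel_measurable lebesgue" "\<And>x. \<bar>f x\<bar> \<le> C"
  shows "f \<in> Linf_loc"
  unfolding Linf_loc_def
proof (intro CollectI allI impI)
  fix K :: "real set" assume K: "compact K"
  have "C \<ge> 0" using assms(2)[of 0] by linarith
  show "(\<lambda>x. indicator K x * f x) \<in> Linf"
  proof (rule LinfI)
    show "(\<lambda>x. indicator K x * f x) \<in> borel_measurable lebesgue"
      by (intro borel_measurable_times borel_measurable_indicator fmeasurableD[OF lmeasurable_compact[OF K]] assms(1))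
    show "AE x in lebesgue. \<bar>indicator K x * f x\<bar> \<le> C"
      using assms(2) \<open>C \<ge> 0\<close> by (intro AE_I2) (simp add: indicator_def)
  qed
qed

lemma H1_primitive:
  assumes "w \<in> H1"
  obtains g where "primitive w g" "w \<in> L2" "g \<in> L2" "AE x in lebesgue. weak_deriv 1 w x = g x"
  using assms weak_deriv_primitive weak_deriv_AE unfolding H1_def by blast

lemma H1I: "primitive w g \<Longrightarrow> w \<in> L2 \<Longrightarrow> g \<in> L2 \<Longrightarrow> w \<in> H1"
  unfolding H1_def using primitive_continuous primitive_has_weak_deriv by blast

text \<open>Replaces both the unspecified representative of the weak derivative and the potential \<open>V\<close>, bounded
  only almost everywhere, by convenient representatives \<open>g\<close> and \<open>W\<close>.\<close>

lemma V_norm_sq_eq: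
  assumes w: "AE x in lebesgue. weak_deriv 1 w x = g x" "w \<in> L2" "g \<in> L2"
    and W: "AE x in lebesgue. V x = W x" "V \<in> borel_measurable lebesgue" "W \<in> borel_measurable lebesgue"
      "\<And>x. \<bar>W x\<bar> \<le> B"
  shows "V_norm_sq V w = integral UNIV (\<lambda>x. (g x)\<^sup>2 + W x * (w x)\<^sup>2)"
proof -
  have wm: "w \<in> borel_measurable lebesgue" and gm: "g \<in> borel_measurable lebesgue"
    using w(2,3) by (auto simp: L2_def)
  have "AE x in lebesgue. g x = weak_deriv 1 w x" using w(1) by eventually_elim simp
  then have wd: "weak_deriv 1 w \<in> borel_measurable lebesgue"
    by (rule borel_measurable_AE[OF gm])
  have i: "integrable lebesgue (\<lambda>x. (g x)\<^sup>2 + W x * (w x)\<^sup>2)"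
    using w(2,3) by (intro Bochner_Integration.integrable_add integrable_bounded_times[OF _ W(3,4)]) (auto simp: L2_def)
  have "V_norm_sq V w = (LINT x|lebesgue. (g x)\<^sup>2 + W x * (w x)\<^sup>2)"
    unfolding V_norm_sq_def
  proof (rule integral_cong_AE)
    show "(\<lambda>x. \<bar>weak_deriv 1 w x\<bar>\<^sup>2 + V x * \<bar>w x\<bar>\<^sup>2) \<in> borel_measurable lebesgue"
      unfolding power2_abs
      by (intro borel_measurable_add borel_measurable_times borel_measurable_power wd wm W)
    show "AE x in lebesgue. \<bar>weak_deriv 1 w x\<bar>\<^sup>2 + V x * \<bar>w x\<bar>\<^sup>2 = (g x)\<^sup>2 + W x * (w x)\<^sup>2"
      using w(1) W(1) by eventually_elim simp
  qed (use i in blast)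
  also have "\<dots> = integral UNIV (\<lambda>x. (g x)\<^sup>2 + W x * (w x)\<^sup>2)"
    by (rule integral_lebesgue[OF i, symmetric])
  finally show ?thesis .
qed

section \<open>The constrained minimizer\<close>

text \<open>\<open>mm\<close> and \<open>mp\<close> are the positive and the negative bounded Riccati solution. They are the logarithmic
  derivatives of the solutions \<open>exp Mm\<close> and \<open>exp Mp\<close> of \<open>\<psi>'' = W \<psi>\<close> that decay at \<open>-\<infinity>\<close> and at \<open>+\<infinity>\<close>
  respectively.\<close>

locale riccati_pair =
  fixes W mm mp Mm Mp :: "real \<Rightarrow> real" and s c :: real
  assumes W_meas: "W \<in> borel_measurable lebesgue" and W_bound: "\<And>x. \<bar>W x\<bar> \<le> c\<^sup>2"
    and s_pos: "0 < s"
    and mm: "primitive mm (\<lambda>x. W x - (mm x)\<^sup>2)" and mm_bound: "\<And>x. s \<le> mm x" "\<And>x. mm x \<le> c"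
    and mp: "primitive mp (\<lambda>x. W x - (mp x)\<^sup>2)" and mp_bound: "\<And>x. - c \<le> mp x" "\<And>x. mp x \<le> - s"
    and Mm: "\<And>x. (Mm has_real_derivative mm x) (at x)"
    and Mp: "\<And>x. (Mp has_real_derivative mp x) (at x)"
begin

lemma continuous_m: "continuous_on UNIV mm" "continuous_on UNIV mp"
  by (rule primitive_continuous[OF mm] primitive_continuous[OF mp])+

lemma abs_m_le: "\<bar>mm x\<bar> \<le> c" "\<bar>mp x\<bar> \<le> c"
  using mm_bound[of x] mp_bound[of x] s_pos by auto

text \<open>The minimizer: the two decaying solutions, normalized and glued at \<open>a\<close>.\<close>

definition peak :: "real \<Rightarrow> real \<Rightarrow> real" where
  "peak a x = (if x < a then exp (Mm x - Mm a) else exp (Mp x - Mp a))"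

definition peak_deriv :: "real \<Rightarrow> real \<Rightarrow> real" where
  "peak_deriv a x = (if x < a then mm x * exp (Mm x - Mm a) else mp x * exp (Mp x - Mp a))"

lemma primitive_peak: "primitive (peak a) (peak_deriv a)"
proof -
  have "continuous_on UNIV Mm" "continuous_on UNIV Mp"
    using Mm Mp by (meson DERIV_continuous_on has_field_derivative_at_within)+
  note c = this continuous_m
  have "primitive (\<lambda>x. exp (Mm x - Mm a)) (\<lambda>x. mm x * exp (Mm x - Mm a))"
    by (rule primitive_of_derivative) (auto intro!: derivative_eq_intros Mm continuous_intros c)
  moreover have "primitive (\<lambda>x. exp (Mp x - Mp a)) (\<lambda>x. mp x * exp (Mp x - Mp a))"
    by (rule primitive_of_derivative) (auto intro!: derivative_eq_intros Mp continuous_intros c)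
  ultimately show ?thesis
    unfolding peak_def[abs_def] peak_deriv_def[abs_def] by (rule primitive_glue) simp
qed

lemma peak_at [simp]: "peak a a = 1" by (simp add: peak_def)

lemma peak_pos: "0 < peak a x" by (simp add: peak_def)

lemma peak_decay: "peak a x \<le> exp (- s * \<bar>x - a\<bar>)"
proof (cases "x < a")
  case True
  obtain y where y: "Mm a - Mm x = (a - x) * mm y"
    using MVT2[OF True, of Mm mm] Mm by blast
  have "s * (a - x) \<le> mm y * (a - x)" using True mm_bound(1)[of y] by (intro mult_right_mono) auto
  then show ?thesis using True y by (simp add: peak_def algebra_simps)
next
  case False
  show ?thesis
  proof (cases "x = a")
    case False
    with \<open>\<not> x < a\<close> have ax: "a < x" by simp
    obtain y where y: "Mp x - Mp a = (x - a) * mp y"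
      using MVT2[OF ax, of Mp mp] Mp by blast
    have "mp y * (x - a) \<le> - s * (x - a)" using ax mp_bound(2)[of y] by (intro mult_right_mono) auto
    then show ?thesis using ax y by (simp add: peak_def algebra_simps)
  qed simp
qed

lemma peak_le_1: "peak a x \<le> 1"
proof -
  have "exp (- s * \<bar>x - a\<bar>) \<le> 1" using s_pos by simp
  with peak_decay[of a x] show ?thesis by linarith
qed

lemma peak_deriv_eq: "peak_deriv a x = (if x < a then mm x else mp x) * peak a x"
  by (simp add: peak_def peak_deriv_def)

lemma peak_L2: "peak a \<in> L2" "peak_deriv a \<in> L2"
proof -
  have m: "peak a \<in> borel_measurable lebesgue"
    by (rule continuous_lebesgue_measurable[OF primitive_continuous[OF primitive_peak]])
  have e: "integrable lebesgue (\<lambda>x. exp (- (2 * s) * \<bar>x - a\<bar>))"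
    by (rule exp_abs_integrable) (use s_pos in simp)
  have 2: "integrable lebesgue (\<lambda>x. (peak a x)\<^sup>2)"
  proof (rule Bochner_Integration.integrable_bound[OF e])
    show "(\<lambda>x. (peak a x)\<^sup>2) \<in> borel_measurable lebesgue" using m by (rule borel_measurable_power)
    have "(peak a x)\<^sup>2 \<le> (exp (- s * \<bar>x - a\<bar>))\<^sup>2" for x
      using peak_decay[of a x] peak_pos[of a x] by (intro power_mono) auto
    then have "(peak a x)\<^sup>2 \<le> exp (- (2 * s) * \<bar>x - a\<bar>)" for x
      by (simp add: power2_eq_square mult_exp_exp mult.assoc)
    then show "AE x in lebesgue. norm ((peak a x)\<^sup>2) \<le> norm (exp (- (2 * s) * \<bar>x - a\<bar>))"
      by (intro AE_I2) simp
  qed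
  with m show L2: "peak a \<in> L2" by (simp add: L2_def)
  have im: "(\<lambda>x. if x < a then mm x else mp x) \<in> borel_measurable lebesgue"
    using continuous_lebesgue_measurable[OF continuous_m(1)] continuous_lebesgue_measurable[OF continuous_m(2)]
    by (intro measurable_If) auto
  then have dm: "peak_deriv a \<in> borel_measurable lebesgue"
    unfolding peak_deriv_eq[abs_def] using m by (rule borel_measurable_times)
  have "integrable lebesgue (\<lambda>x. (if x < a then mm x else mp x)\<^sup>2 * (peak a x)\<^sup>2)"
  proof (rule integrable_bounded_times[OF 2])
    show "(\<lambda>x. (if x < a then mm x else mp x)\<^sup>2) \<in> borel_measurable lebesgue"
      using im by (rule borel_measurable_power)
    show "\<bar>(if x < a then mm x else mp x)\<^sup>2\<bar> \<le> c\<^sup>2" for x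
      using power_mono[OF abs_m_le(1), of x 2] power_mono[OF abs_m_le(2), of x 2] by simp
  qed
  then have "integrable lebesgue (\<lambda>x. (peak_deriv a x)\<^sup>2)"
    unfolding peak_deriv_eq power_mult_distrib .
  with dm show "peak_deriv a \<in> L2" by (simp add: L2_def)
qed

lemma peak_in_K: "peak a \<in> K_set a"
  unfolding K_set_def
proof (intro CollectI conjI)
  show "peak a \<in> H1" by (rule H1I[OF primitive_peak peak_L2])
  have "\<bar>peak a x\<bar> \<le> 1" for x using peak_pos[of a x] peak_le_1[of a x] by simp
  then show "Linf_norm (peak a) = 1"
    by (rule Linf_norm_eq_1[OF primitive_continuous[OF primitive_peak] _ peak_at])
qed simp

definition defect :: "real \<Rightarrow> (real \<Rightarrow> real) \<Rightarrow> (real \<Rightarrow> real) \<Rightarrow> real" where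
  "defect a w g = integral {..a} (\<lambda>x. (g x - mm x * w x)\<^sup>2) + integral {a..} (\<lambda>x. (g x - mp x * w x)\<^sup>2)"

text \<open>The identity behind the whole theorem: the energy of any competitor is \<open>mm a - mp a\<close> plus a defect
  that is a sum of two integrals of squares. The boundary terms at \<open>a\<close> depend on \<open>w\<close> through \<open>w a = 1\<close> only, so
  minimizing the energy amounts to making the defect vanish.\<close>

lemma energy_eq:
  assumes "primitive w g" "w \<in> L2" "g \<in> L2" "w a = 1"
  shows "integral UNIV (\<lambda>x. (g x)\<^sup>2 + W x * (w x)\<^sup>2) = mm a - mp a + defect a w g"
  using riccati_energy(4)[OF mm abs_m_le(1) W_meas W_bound assms(1-3), of a]
    riccati_energy(3)[OF mp abs_m_le(2) W_meas W_bound assms(1-3), of a]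
    integral_split_at[OF riccati_energy(1)[OF mp abs_m_le(2) W_meas W_bound assms(1-3)], of a] assms(4)
  by (simp add: defect_def)

lemma defect_nonneg: "0 \<le> defect a w g"
  unfolding defect_def
  by (intro add_nonneg_nonneg integral_power2_nonneg)

lemma defect_peak: "defect a (peak a) (peak_deriv a) = 0"
proof -
  have "integral {..a} (\<lambda>x. (peak_deriv a x - mm x * peak a x)\<^sup>2) = integral {..a} (\<lambda>_. 0)"
    by (rule integral_spike[of "{a}"]) (auto simp: peak_deriv_eq)
  moreover have "integral {a..} (\<lambda>x. (peak_deriv a x - mp x * peak a x)\<^sup>2) = integral {a..} (\<lambda>_. 0)"
    by (rule integral_cong) (auto simp: peak_deriv_eq)
  ultimately show ?thesis by (simp add: defect_def)
qed

text \<open>If both squares vanish, then \<open>w' = mm w\<close> to the left of \<open>a\<close> and \<open>w' = mp w\<close> to the right.\<close>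

lemma defect_zero_imp_peak:
  assumes w: "primitive w g" "w \<in> L2" "g \<in> L2" "w a = 1" and z: "defect a w g = 0"
  shows "w = peak a"
proof
  fix x
  note Dm = riccati_energy(2)[OF mm abs_m_le(1) W_meas W_bound w(1-3)]
  note Dp = riccati_energy(2)[OF mp abs_m_le(2) W_meas W_bound w(1-3)]
  have "0 \<le> integral {..a} (\<lambda>x. (g x - mm x * w x)\<^sup>2)" "0 \<le> integral {a..} (\<lambda>x. (g x - mp x * w x)\<^sup>2)"
    by (rule integral_power2_nonneg)+
  with z have zm: "integral {..a} (\<lambda>x. (g x - mm x * w x)\<^sup>2) = 0" and zp: "integral {a..} (\<lambda>x. (g x - mp x * w x)\<^sup>2) = 0"
    by (auto simp: defect_def)
  show "w x = peak a x"
  proof (cases "x < a")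
    case True
    have "AE y in lebesgue. y \<in> {..a} \<longrightarrow> (g y - mm y * w y)\<^sup>2 = 0"
      by (rule integral_zero_imp_AE[OF Dm _ _ zm]) auto
    then have "AE y in lebesgue. y \<in> {x..a} \<longrightarrow> g y = mm y * w y" by eventually_elim auto
    from linear_ode_unique[OF w(1) Mm continuous_m(1) this] True w(4)
    have "w x * exp (- Mm x) = exp (- Mm a)" by simp
    then have "w x * exp (- Mm x) * exp (Mm x) = exp (- Mm a) * exp (Mm x)" by simp
    then show ?thesis using True by (simp add: peak_def mult_exp_exp mult.assoc)
  next
    case False
    have "AE y in lebesgue. y \<in> {a..} \<longrightarrow> (g y - mp y * w y)\<^sup>2 = 0"
      by (rule integral_zero_imp_AE[OF Dp _ _ zp]) auto
    then have "AE y in lebesgue. y \<in> {a..x} \<longrightarrow> g y = mp y * w y" by eventually_elim auto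
    from linear_ode_unique[OF w(1) Mp continuous_m(2) this] False w(4)
    have "w x * exp (- Mp x) = exp (- Mp a)" by simp
    then have "w x * exp (- Mp x) * exp (Mp x) = exp (- Mp a) * exp (Mp x)" by simp
    then show ?thesis using False by (simp add: peak_def mult_exp_exp mult.assoc)
  qed
qed

lemma peak_right_deriv: "right_deriv (peak a) a = mp a"
  unfolding right_deriv_def
proof (rule vector_derivative_within)
  have "((\<lambda>x. exp (Mp x - Mp a)) has_real_derivative mp a) (at a within {a..})"
    by (auto intro!: derivative_eq_intros has_field_derivative_at_within[OF Mp])
  then have "(peak a has_real_derivative mp a) (at a within {a..})"
    by (rule has_field_derivative_transform_within[where d=1]) (auto simp: peak_def)
  then show "(peak a has_vector_derivative mp a) (at_right a)"
    unfolding has_real_derivative_iff_has_vector_derivative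
    by (rule has_vector_derivative_within_subset) auto
qed (simp add: trivial_limit_at_right_real trivial_limit_at_left_real)

lemma peak_left_deriv: "left_deriv (peak a) a = mm a"
  unfolding left_deriv_def
proof (rule vector_derivative_within)
  have "((\<lambda>x. exp (Mm x - Mm a)) has_real_derivative mm a) (at a within {..a})"
    by (auto intro!: derivative_eq_intros has_field_derivative_at_within[OF Mm])
  then have "(peak a has_real_derivative mm a) (at a within {..a})"
    by (rule has_field_derivative_transform_within[where d=1]) (auto simp: peak_def)
  then show "(peak a has_vector_derivative mm a) (at_left a)"
    unfolding has_real_derivative_iff_has_vector_derivative
    by (rule has_vector_derivative_within_subset) auto
qed (simp add: trivial_limit_at_right_real trivial_limit_at_left_real)

text \<open>The Riccati solutions want a potential bounded at every point, the energy is defined with \<open>V\<close>; the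
  two potentials agree almost everywhere.\<close>

context
  fixes V :: "real \<Rightarrow> real"
  assumes VW: "AE x in lebesgue. V x = W x" and V_meas: "V \<in> borel_measurable lebesgue"
begin

lemma V_norm_sq_defect:
  assumes "w \<in> K_set a"
  obtains g where "primitive w g" "w \<in> L2" "g \<in> L2" "w a = 1" "V_norm_sq V w = mm a - mp a + defect a w g"
proof -
  from assms have "w \<in> H1" and 1: "w a = 1" by (auto simp: K_set_def)
  from H1_primitive[OF this(1)] obtain g where g: "primitive w g" "w \<in> L2" "g \<in> L2" "AE x in lebesgue. weak_deriv 1 w x = g x" .
  have "V_norm_sq V w = mm a - mp a + defect a w g"
    using V_norm_sq_eq[OF g(4,2,3) VW V_meas W_meas W_bound] energy_eq[OF g(1-3) 1] by simp
  with g 1 show ?thesis using that by blast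
qed

lemma V_norm_sq_peak: "V_norm_sq V (peak a) = mm a - mp a"
proof -
  have "AE x in lebesgue. weak_deriv 1 (peak a) x = peak_deriv a x"
    by (rule weak_deriv_AE[OF primitive_has_weak_deriv[OF primitive_peak]])
  from V_norm_sq_eq[OF this peak_L2 VW V_meas W_meas W_bound] energy_eq[OF primitive_peak peak_L2 peak_at]
  show ?thesis by (simp add: defect_peak)
qed

lemma V_norm_sq_ge: "w \<in> K_set a \<Longrightarrow> mm a - mp a \<le> V_norm_sq V w"
  using V_norm_sq_defect defect_nonneg by (metis le_add_same_cancel1)

lemma F_min_eq: "F_min V a = mm a - mp a"
  unfolding F_min_def
proof (rule cInf_eq_minimum)
  show "mm a - mp a \<in> V_norm_sq V ` K_set a" using peak_in_K V_norm_sq_peak by (metis imageI)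
qed (use V_norm_sq_ge in blast)

lemma minimizer_eq: "minimizer V a = peak a"
  unfolding minimizer_def
proof (rule the_equality)
  show "peak a \<in> K_set a \<and> (\<forall>w\<in>K_set a. V_norm_sq V (peak a) \<le> V_norm_sq V w)"
    using peak_in_K V_norm_sq_ge V_norm_sq_peak by simp
  fix u assume u: "u \<in> K_set a \<and> (\<forall>w\<in>K_set a. V_norm_sq V u \<le> V_norm_sq V w)"
  then obtain g where g: "primitive u g" "u \<in> L2" "g \<in> L2" "u a = 1" "V_norm_sq V u = mm a - mp a + defect a u g"
    using V_norm_sq_defect by blast
  have "V_norm_sq V u \<le> mm a - mp a" using u peak_in_K V_norm_sq_peak by metis
  with g(5) defect_nonneg[of a u g] have "defect a u g = 0" by linarith
  from defect_zero_imp_peak[OF g(1-4) this] show "u = peak a" .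
qed

end

end

section \<open>Regularity of the minimal energy\<close>

lemma Ck_2I:
  assumes "\<And>x. (f has_real_derivative g x) (at x)" "\<And>x. (g has_real_derivative h x) (at x)" "continuous_on UNIV h"
  shows "f \<in> Ck 2"
proof -
  have "deriv f = g" "deriv g = h" using assms DERIV_imp_deriv by blast+
  moreover have "f differentiable at x" "g differentiable at x" for x
    using assms real_differentiable_def by blast+
  ultimately show ?thesis using assms(3) unfolding Ck_def by (auto simp: numeral_2_eq_2 less_Suc_eq)
qed

lemma Ck_1I:
  assumes "\<And>x. (f has_real_derivative g x) (at x)" "continuous_on UNIV g"
  shows "f \<in> Ck 1"
proof -
  have "deriv f = g" using assms DERIV_imp_deriv by blast
  moreover have "f differentiable at x" for x
    using assms real_differentiable_def by blast
  ultimately show ?thesis using assms(2) unfolding Ck_def by auto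
qed

theorem theorem4p1:
  fixes V :: "real \<Rightarrow> real" and v0 v1 :: real
  assumes "V \<in> Linf"
    and "0 < v0"
    and "AE x in lebesgue. v0 \<le> V x \<and> V x \<le> v1"
  defines "F \<equiv> F_min V"
    and "dp \<equiv> \<lambda>a. right_deriv (minimizer V a) a"
    and "dm \<equiv> \<lambda>a. left_deriv (minimizer V a) a"
  shows "F \<in> W2inf_loc \<and>
    (\<forall>a. F a = dm a - dp a) \<and>
    (\<forall>a. (F has_real_derivative \<bar>dp a\<bar>\<^sup>2 - \<bar>dm a\<bar>\<^sup>2) (at a)) \<and>
    (AE a in lebesgue. weak_deriv 2 F a =
        2 * F a * (\<bar>dp a\<bar>\<^sup>2 + dp a * dm a + \<bar>dm a\<bar>\<^sup>2 - V a)) \<and>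
    (continuous_on UNIV V \<longrightarrow> F \<in> Ck 2)"
proof -
  \<comment> \<open>truncating \<open>V\<close> keeps it continuous if it was, which the last claim needs\<close>
  define W where "W = (\<lambda>x. max v0 (min v1 (V x)))"
  define s c where "s = sqrt v0" and "c = sqrt v1"
  have V_meas: "V \<in> borel_measurable lebesgue" using assms(1) by (simp add: Linf_def)
  have v01: "v0 \<le> v1"
  proof -
    have False if "\<not> v0 \<le> v1"
    proof -
      have "AE x in lebesgue. x \<notin> (UNIV :: real set)"
        using assms(3) by eventually_elim (use that in simp)
      from AE_open_complement[OF open_UNIV this] show False by simp
    qed
    then show ?thesis by blast
  qed
  have VW: "AE x in lebesgue. V x = W x"
    using assms(3) by eventually_elim (simp add: W_def)
  have W_meas: "W \<in> borel_measurable lebesgue"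
    unfolding W_def by (intro borel_measurable_max borel_measurable_min borel_measurable_const V_meas)
  have sc: "0 < s" "s \<le> c" "s\<^sup>2 = v0" "c\<^sup>2 = v1"
    using assms(2) v01 by (auto simp: s_def c_def)
  have W: "s\<^sup>2 \<le> W x" "W x \<le> c\<^sup>2" for x using v01 by (auto simp: W_def sc)
  obtain mm where mm: "primitive mm (\<lambda>x. W x - (mm x)\<^sup>2)" "\<And>x. s \<le> mm x \<and> mm x \<le> c"
    using riccati_positive_solution[OF W_meas W sc(1,2)] by blast
  obtain mp where mp: "primitive mp (\<lambda>x. W x - (mp x)\<^sup>2)" "\<And>x. - c \<le> mp x \<and> mp x \<le> - s"
    using riccati_negative_solution[OF W_meas W sc(1,2)] by blast
  note cont = primitive_continuous[OF mm(1)] primitive_continuous[OF mp(1)]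
  have "\<exists>M. primitive M mm" "\<exists>M. primitive M mp"
    by (rule L1_loc_primitive, rule primitive_L1_loc(2), fact)+
  then obtain Mm Mp where M: "primitive Mm mm" "primitive Mp mp" by blast
  interpret riccati_pair W mm mp Mm Mp s c
  proof
    show "\<bar>W x\<bar> \<le> c\<^sup>2" for x using W[of x] zero_le_power2[of s] by linarith
  qed (use W_meas sc mm mp derivative_of_primitive[OF M(1) cont(1)] derivative_of_primitive[OF M(2) cont(2)] in auto)
  have F: "F = (\<lambda>a. mm a - mp a)" unfolding F_def by (intro ext F_min_eq VW V_meas)
  have dp: "dp = mp" unfolding dp_def by (simp add: minimizer_eq[OF VW V_meas] peak_right_deriv)
  have dm: "dm = mm" unfolding dm_def by (simp add: minimizer_eq[OF VW V_meas] peak_left_deriv)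
  \<comment> \<open>the Riccati equations: \<open>mm' - mp' = mp\<^sup>2 - mm\<^sup>2\<close>, with \<open>W\<close> cancelling\<close>
  define F1 where "F1 = (\<lambda>x. (mp x)\<^sup>2 - (mm x)\<^sup>2)"
  define F2 where "F2 = (\<lambda>x. 2 * F x * ((mp x)\<^sup>2 + mp x * mm x + (mm x)\<^sup>2 - W x))"
  have "primitive F (\<lambda>x. (W x - (mm x)\<^sup>2) - (W x - (mp x)\<^sup>2))"
    unfolding F by (rule primitive_diff[OF mm(1) mp(1)])
  moreover have "(\<lambda>x. (W x - (mm x)\<^sup>2) - (W x - (mp x)\<^sup>2)) = F1" by (simp add: F1_def)
  ultimately have P1: "primitive F F1" by simp
  \<comment> \<open>\<open>(mp\<^sup>2 - mm\<^sup>2)' = 2 W (mp - mm) - 2 (mp\<^sup>3 - mm\<^sup>3)\<close>, and \<open>mp - mm = - F\<close> is a factor\<close>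
  have P2: "primitive F1 F2"
  proof -
    have "primitive (\<lambda>x. mp x * mp x - mm x * mm x)
      (\<lambda>x. ((W x - (mp x)\<^sup>2) * mp x + mp x * (W x - (mp x)\<^sup>2)) - ((W x - (mm x)\<^sup>2) * mm x + mm x * (W x - (mm x)\<^sup>2)))"
      by (intro primitive_diff primitive_mult mm(1) mp(1))
    moreover have "(\<lambda>x. ((W x - (mp x)\<^sup>2) * mp x + mp x * (W x - (mp x)\<^sup>2)) - ((W x - (mm x)\<^sup>2) * mm x + mm x * (W x - (mm x)\<^sup>2))) = F2"
      by (simp add: F2_def F fun_eq_iff power2_eq_square algebra_simps)
    ultimately show ?thesis by (simp add: F1_def power2_eq_square)
  qed
  have F1c: "continuous_on UNIV F1" unfolding F1_def by (intro continuous_intros cont)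
  have dF: "(F has_real_derivative F1 x) (at x)" for x
    by (rule derivative_of_primitive[OF P1 F1c])
  have W2: "has_weak_deriv 2 F F2"
    by (intro has_weak_deriv_2[of F F1] primitive_has_weak_deriv P1 P2)
  have mb: "\<bar>mm x\<bar> \<le> c" "\<bar>mp x\<bar> \<le> c" for x by (rule abs_m_le)+
  have sq: "(mm x)\<^sup>2 \<le> c\<^sup>2" "(mp x)\<^sup>2 \<le> c\<^sup>2" for x
    using power_mono[OF mb(1), of x 2] power_mono[OF mb(2), of x 2] by auto
  have Fb: "\<bar>F x\<bar> \<le> 2 * c" for x using mb(1)[of x] mb(2)[of x] unfolding F by linarith
  have F1b: "\<bar>F1 x\<bar> \<le> 2 * c\<^sup>2" for x
    using sq[of x] zero_le_power2[of "mm x"] zero_le_power2[of "mp x"] unfolding F1_def by linarith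
  have F2b: "\<bar>F2 x\<bar> \<le> 2 * (2 * c) * (4 * c\<^sup>2)" for x
  proof -
    have "\<bar>mp x * mm x\<bar> \<le> c * c" unfolding abs_mult using mb sc(1,2) by (intro mult_mono) auto
    then have "\<bar>(mp x)\<^sup>2 + mp x * mm x + (mm x)\<^sup>2 - W x\<bar> \<le> 4 * c\<^sup>2"
      using sq[of x] W_bound[of x] zero_le_power2[of "mm x"] zero_le_power2[of "mp x"]
      unfolding power2_eq_square[of c] by linarith
    then show ?thesis unfolding F2_def abs_mult using Fb[of x] by (intro mult_mono) auto
  qed
  have F2m: "F2 \<in> borel_measurable lebesgue"
    unfolding F2_def
    by (intro borel_measurable_times borel_measurable_add borel_measurable_diff borel_measurable_power
        borel_measurable_const W_meas continuous_lebesgue_measurable[OF cont(1)] continuous_lebesgue_measurable[OF cont(2)]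
        continuous_lebesgue_measurable[OF primitive_continuous[OF P1]])
  have "F \<in> W2inf_loc"
    unfolding W2inf_loc_def
  proof (intro CollectI conjI bexI)
    show "F \<in> Ck 1" by (rule Ck_1I[OF dF F1c])
    show "F \<in> Linf_loc"
      by (rule Linf_locI[OF continuous_lebesgue_measurable[OF primitive_continuous[OF P1]] Fb])
    show "has_weak_deriv 1 F F1" by (rule primitive_has_weak_deriv[OF P1])
    show "F1 \<in> Linf_loc" by (rule Linf_locI[OF continuous_lebesgue_measurable[OF F1c] F1b])
    show "F2 \<in> Linf_loc" by (rule Linf_locI[OF F2m F2b])
  qed (rule W2)
  moreover have "\<forall>a. F a = dm a - dp a" by (simp add: F dm dp)
  moreover have "\<forall>a. (F has_real_derivative \<bar>dp a\<bar>\<^sup>2 - \<bar>dm a\<bar>\<^sup>2) (at a)"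
    using dF by (simp add: F1_def dm dp)
  moreover have "AE a in lebesgue. weak_deriv 2 F a = 2 * F a * (\<bar>dp a\<bar>\<^sup>2 + dp a * dm a + \<bar>dm a\<bar>\<^sup>2 - V a)"
    using weak_deriv_AE[OF W2] VW by eventually_elim (simp add: F2_def dm dp)
  moreover have "continuous_on UNIV V \<longrightarrow> F \<in> Ck 2"
  proof
    assume "continuous_on UNIV V"
    then have "continuous_on UNIV F2" unfolding F2_def F W_def by (intro continuous_intros cont)
    then show "F \<in> Ck 2"
      by (intro Ck_2I[OF dF derivative_of_primitive[OF P2]])
  qed
  ultimately show ?thesis by blast
qed

end
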